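(* Let $d\in\mathbb{N}$ and let $\varphi\colon(0,1]\to[0,d]$ be a function. Then there exists a non-empty set $F\subset\mathbb{R}^d$ such that $(1-\theta)\dim^{\theta}_{\mathrm{L}}F=\varphi(\theta)$ for all $\theta\in(0,1]$ if and only if for all $\lambda,\theta\in(0,1]$, $$\varphi(\theta)\leq\varphi(\lambda\theta)-\theta\varphi(\lambda)\leq(1-\theta)d.$$
   Context: For a metric space $X$, $B(x,r)$ denotes the closed ball in $X$ with centre $x$ and radius $r$, and for $E\subset X$, $N_r(E)$ denotes the least number of closed balls of radius $r$ required to cover $E$. A subset of $\mathbb{R}^d$ is regarded as a metric space with the Euclidean metric. For $0<\theta<1$ the lower spectrum of $X$ is $$\dim^{\theta}_{\mathrm{L}}X=\sup\Bigl\{s\geq0:\exists C>0\ \forall\,0<r<1,\ \inf_{x\in X}N_r(B(x,r^\theta))\geq C\Bigl(\frac{r^\theta}{r}\Bigr)^s\Bigr\}.$$ For $\theta=1$, the expression $(1-\theta)\dim^{\theta}_{\mathrm{L}}F$ is defined to be $0$ (its limiting value). *)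

theory Defs
  imports "HOL-Analysis.Analysis"
begin

text \<open>
  A subset \<open>X\<close> of a metric space is treated as a metric space in its own right: balls are
  relative to \<open>X\<close> and have their centres in \<open>X\<close>.
\<close>

definition rel_cball :: "'a::metric_space set \<Rightarrow> 'a \<Rightarrow> real \<Rightarrow> 'a set" where
  "rel_cball X x r = cball x r \<inter> X"

text \<open>The value is \<open>\<infinity>\<close> if \<open>E\<close> has no finite cover.\<close>

definition covering_number :: "'a::metric_space set \<Rightarrow> real \<Rightarrow> 'a set \<Rightarrow> enat" where
  "covering_number X r E =
     Inf {enat (card A) | A. finite A \<and> A \<subseteq> X \<and> E \<subseteq> (\<Union>a\<in>A. rel_cball X a r)}"

text \<open>Only meant for \<open>0 < \<theta> < 1\<close>; the supremum is taken in the extended reals.\<close>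

definition lower_spectrum :: "real \<Rightarrow> 'a::metric_space set \<Rightarrow> ereal" where
  "lower_spectrum \<theta> X =
     Sup (ereal ` {s. s \<ge> 0 \<and> (\<exists>C>0. \<forall>r. 0 < r \<and> r < 1 \<longrightarrow>
       ereal_of_enat (INF x\<in>X. covering_number X r (rel_cball X x (r powr \<theta>)))
         \<ge> ereal (C * (r powr \<theta> / r) powr s))})"

text \<open>The product \<open>(1 - \<theta>) * lower_spectrum \<theta> X\<close>, with its limiting value \<open>0\<close> at \<open>\<theta> = 1\<close>.\<close>

definition scaled_lower_spectrum :: "real \<Rightarrow> 'a::metric_space set \<Rightarrow> ereal" where
  "scaled_lower_spectrum \<theta> X =
     (if \<theta> = 1 then 0 else ereal (1 - \<theta>) * lower_spectrum \<theta> X)"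

end

theory Submission
  imports Defs
begin

text \<open>
  For \<open>0 < \<theta> < 1\<close> put \<open>m(r, R) = inf\<^sub>x N\<^sub>r(B(x, R))\<close>. The scaled spectrum
  \<open>(1 - \<theta>) dim\<^sub>L\<^sup>\<theta> X\<close> is the supremum of the exponents \<open>t\<close> for which
  \<open>m(r, r\<^sup>\<theta>)\<close> is bounded below by a constant times \<open>r\<^sup>-\<^sup>t\<close>; this is
  \<open>scaled_lower_spectrum_eq_iff\<close>, and everything else is about such exponents.

  Necessity compares three scales \<open>r < r\<^sup>\<theta> < r\<^sup>\<mu>\<^sup>\<theta>\<close>. Up to constants,
  \<open>m(r\<^sub>1, r\<^sub>3) \<ge> m(r\<^sub>1, r\<^sub>2) m(r\<^sub>2, r\<^sub>3)\<close>, because the large ball contains many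
  well separated balls of the middle radius (\<open>covering_growth_mult\<close>), and
  \<open>m(r\<^sub>1, r\<^sub>3) \<le> (r\<^sub>2/r\<^sub>1)\<^sup>d m(r\<^sub>2, r\<^sub>3)\<close>, because Euclidean balls are doubling
  (\<open>covering_growth_div\<close>). Taking exponents turns these into the two inequalities for \<open>\<phi>\<close>.

  Sufficiency is a construction. In logarithmic coordinates (scale \<open>2\<^sup>-\<^sup>u\<close>), let
  \<open>h\<^sub>k(u) = u \<phi>(k/u)\<close> for \<open>u \<ge> k\<close>. The two inequalities for \<open>\<phi>\<close> say exactly that, for
  all \<open>0 < k \<le> u \<le> w\<close>,
  \<open>w \<phi>(u/w) \<le> h\<^sub>k(w) - h\<^sub>k(u) \<le> d (w - u)\<close>.
  The upper bound makes \<open>h\<^sub>k\<close> realisable, up to a bounded error, as the logarithmic covering number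
  of a homogeneous Cantor-like set of diameter about \<open>2\<^sup>-\<^sup>k\<close>: all vectors whose coordinates have
  binary digits only at the places in a set \<open>J\<close>, where \<open>J\<close> has about \<open>h\<^sub>k(u)/d\<close> elements up to
  \<open>u\<close>. The lower bound says that balls inside this set are nowhere too thin for \<open>\<phi>\<close>. At the top
  scale \<open>u = k\<close> the lower bound is an equality, so this piece certifies that the exponent at
  \<open>\<theta>\<close> is no larger than \<open>\<phi> \<theta>\<close>; the scales involved tend to 0 with \<open>k\<close>.

  A single homogeneous set does not suffice, since \<open>h\<^sub>k\<close> cannot in general be continued to scales
  coarser than \<open>2\<^sup>-\<^sup>k\<close>: the function \<open>\<phi>\<close> may have slope below \<open>-d\<close>. Instead, at distance
  comparable to \<open>2\<^sup>-\<^sup>k\<close> from each thin piece there is a piece of unit size in which all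
  digits are free. A ball around a point of the thin piece that is large compared to
  \<open>2\<^sup>-\<^sup>k\<close> contains a ball of half the radius around a point of the full piece, and so has the
  largest possible covering number. The final set is the union of these pairs of pieces for
  \<open>k \<ge> 1\<close>, placed far apart.
\<close>

section \<open>The scaled lower spectrum as a critical exponent\<close>

definition is_cover :: "'a::metric_space set \<Rightarrow> real \<Rightarrow> 'a set \<Rightarrow> 'a set \<Rightarrow> bool" where
  "is_cover X r E A \<longleftrightarrow> finite A \<and> A \<subseteq> X \<and> E \<subseteq> (\<Union>a\<in>A. rel_cball X a r)"

definition covering_growth :: "'a::metric_space set \<Rightarrow> real \<Rightarrow> real \<Rightarrow> bool" where
  "covering_growth X \<theta> t \<longleftrightarrow> (\<exists>C>0. \<forall>r. 0 < r \<and> r < 1 \<longrightarrow>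
     (\<forall>x\<in>X. \<forall>A. is_cover X r (rel_cball X x (r powr \<theta>)) A \<longrightarrow> C * r powr (-t) \<le> real (card A)))"

text \<open>
  This removes \<open>enat\<close> and the infimum: a lower bound on the infimum is a lower bound on the size of
  every cover of every member.
\<close>

lemma le_Inf_covering_number_iff:
  "ereal c \<le> ereal_of_enat (INF x\<in>X. covering_number X r (E x)) \<longleftrightarrow>
     (\<forall>x\<in>X. \<forall>A. is_cover X r (E x) A \<longrightarrow> c \<le> real (card A))"
proof
  assume L: "ereal c \<le> ereal_of_enat (INF x\<in>X. covering_number X r (E x))"
  show "\<forall>x\<in>X. \<forall>A. is_cover X r (E x) A \<longrightarrow> c \<le> real (card A)"
  proof (intro ballI allI impI)
    fix x A assume x: "x \<in> X" and A: "is_cover X r (E x) A"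
    have "(INF x\<in>X. covering_number X r (E x)) \<le> covering_number X r (E x)"
      using x by (rule INF_lower)
    also have "\<dots> \<le> enat (card A)"
      unfolding covering_number_def using A by (intro Inf_lower) (auto simp: is_cover_def)
    finally have "ereal_of_enat (INF x\<in>X. covering_number X r (E x)) \<le> ereal_of_enat (enat (card A))"
      by (simp only: ereal_of_enat_le_iff)
    with L have "ereal c \<le> ereal_of_enat (enat (card A))" by (rule order_trans)
    then show "c \<le> real (card A)" by simp
  qed
next
  assume R: "\<forall>x\<in>X. \<forall>A. is_cover X r (E x) A \<longrightarrow> c \<le> real (card A)"
  show "ereal c \<le> ereal_of_enat (INF x\<in>X. covering_number X r (E x))"
  proof (cases "INF x\<in>X. covering_number X r (E x)")
    case (enat m)
    have attained: "Inf S \<in> S" if "Inf S \<noteq> \<infinity>" for S :: "enat set"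
      using that by (cases "S = {}") (auto simp: Inf_enat_def intro: LeastI)
    have "(INF x\<in>X. covering_number X r (E x)) \<in> (\<lambda>x. covering_number X r (E x)) ` X"
      using enat by (intro attained) simp
    then obtain x where x: "x \<in> X" "covering_number X r (E x) = enat m"
      using enat by auto
    then have "enat m \<in> {enat (card A) |A. is_cover X r (E x) A}"
      using attained[of "{enat (card A) |A. is_cover X r (E x) A}"]
      by (simp add: covering_number_def is_cover_def)
    then obtain A where "is_cover X r (E x) A" "m = card A" by auto
    then show ?thesis using R x enat by auto
  qed simp
qed

lemma lower_spectrum_eq_Sup_growth:
  shows "lower_spectrum \<theta> X = Sup (ereal ` {s. 0 \<le> s \<and> covering_growth X \<theta> ((1 - \<theta>) * s)})"
proof -
  have pow: "(r powr \<theta> / r) powr s = r powr (- ((1 - \<theta>) * s))" if "0 < r" for r s :: real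
  proof -
    have "r powr \<theta> / r = r powr (\<theta> - 1)" using that by (simp add: powr_diff)
    then show ?thesis by (simp add: powr_powr algebra_simps)
  qed
  have "(\<exists>C>0. \<forall>r. 0 < r \<and> r < 1 \<longrightarrow>
       ereal_of_enat (INF x\<in>X. covering_number X r (rel_cball X x (r powr \<theta>)))
         \<ge> ereal (C * (r powr \<theta> / r) powr s)) \<longleftrightarrow> covering_growth X \<theta> ((1 - \<theta>) * s)" for s
    unfolding covering_growth_def le_Inf_covering_number_iff by (metis pow)
  then show ?thesis unfolding lower_spectrum_def by simp
qed

lemma is_cover_card_ge_1:
  assumes "is_cover X r (rel_cball X x R) A" "x \<in> X" "0 \<le> R"
  shows "1 \<le> card A"
proof -
  have "x \<in> rel_cball X x R" using assms by (simp add: rel_cball_def)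
  then have "A \<noteq> {}" "finite A" using assms by (auto simp: is_cover_def)
  then show ?thesis by (simp add: Suc_le_eq card_gt_0_iff)
qed

lemma covering_growth_antimono:
  assumes "covering_growth X \<theta> t" "t' \<le> t"
  shows "covering_growth X \<theta> t'"
proof -
  obtain C where C: "C > 0"
    "\<And>r x A. 0 < r \<Longrightarrow> r < 1 \<Longrightarrow> x \<in> X \<Longrightarrow> is_cover X r (rel_cball X x (r powr \<theta>)) A
       \<Longrightarrow> C * r powr (-t) \<le> real (card A)"
    using assms(1) unfolding covering_growth_def by blast
  have "C * r powr (-t') \<le> real (card A)"
    if "0 < r" "r < 1" "x \<in> X" "is_cover X r (rel_cball X x (r powr \<theta>)) A" for r x A
  proof -
    have "r powr (-t') \<le> r powr (-t)" using that assms by (simp add: powr_mono')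
    then show ?thesis using C(2)[OF that] C(1) by (smt (verit) mult_left_mono)
  qed
  then show ?thesis unfolding covering_growth_def using C(1) by blast
qed

lemma covering_growth_nonpos:
  assumes "t \<le> 0"
  shows "covering_growth X \<theta> t"
proof -
  have "covering_growth X \<theta> 0"
    unfolding covering_growth_def
    by (intro exI[of _ 1]) (auto dest: is_cover_card_ge_1)
  then show ?thesis using assms by (rule covering_growth_antimono)
qed

text \<open>
  The factor \<open>1 - \<theta>\<close> is absorbed by the substitution \<open>t = (1 - \<theta>) s\<close>. The right-hand side also
  speaks of negative \<open>t\<close>, which the definition of the spectrum excludes; this is harmless because a
  nonempty ball needs at least one covering ball, so nonpositive exponents are always attained.
\<close>

lemma scaled_lower_spectrum_eq_iff:
  assumes "0 < \<theta>" "\<theta> < 1" "0 \<le> p"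
  shows "scaled_lower_spectrum \<theta> X = ereal p \<longleftrightarrow>
     (\<forall>t<p. covering_growth X \<theta> t) \<and> (\<forall>t. covering_growth X \<theta> t \<longrightarrow> t \<le> p)"
    (is "_ \<longleftrightarrow> ?R")
proof -
  define S where "S = {s. 0 \<le> s \<and> covering_growth X \<theta> ((1 - \<theta>) * s)}"
  define q where "q = p / (1 - \<theta>)"
  have q: "0 \<le> q" "p = (1 - \<theta>) * q" using assms by (auto simp: q_def)
  have "scaled_lower_spectrum \<theta> X = ereal (1 - \<theta>) * Sup (ereal ` S)"
    using assms by (simp add: scaled_lower_spectrum_def lower_spectrum_eq_Sup_growth S_def)
  moreover have "ereal (1 - \<theta>) * y = ereal p \<longleftrightarrow> y = ereal q" for y
    using assms by (cases y) (simp_all add: q)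
  ultimately have "scaled_lower_spectrum \<theta> X = ereal p \<longleftrightarrow> Sup (ereal ` S) = ereal q"
    by simp
  also have "\<dots> \<longleftrightarrow> ?R"
  proof
    assume L: "Sup (ereal ` S) = ereal q"
    have "covering_growth X \<theta> t" if "t < p" for t
    proof -
      have "ereal (t / (1 - \<theta>)) < Sup (ereal ` S)"
        using that assms unfolding L by (simp add: q_def divide_strict_right_mono)
      then obtain s where s: "s \<in> S" "t / (1 - \<theta>) < s" by (auto simp: less_SUP_iff)
      then have "covering_growth X \<theta> ((1 - \<theta>) * s)" "t \<le> (1 - \<theta>) * s"
        using assms by (auto simp: S_def pos_divide_less_eq mult.commute)
      then show ?thesis by (rule covering_growth_antimono)
    qed
    moreover have "t \<le> p" if "covering_growth X \<theta> t" for t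
    proof (cases "t \<le> 0")
      case False
      then have "t / (1 - \<theta>) \<in> S" using that assms by (simp add: S_def)
      then have "ereal (t / (1 - \<theta>)) \<le> ereal q" unfolding L[symmetric] by (simp add: SUP_upper)
      then show ?thesis using assms by (simp add: q_def divide_le_cancel)
    qed (use assms in simp)
    ultimately show ?R by blast
  next
    assume R: ?R
    show "Sup (ereal ` S) = ereal q"
    proof (rule antisym)
      show "Sup (ereal ` S) \<le> ereal q"
      proof (intro SUP_least)
        fix s assume "s \<in> S"
        then have "(1 - \<theta>) * s \<le> (1 - \<theta>) * q" using R by (simp add: S_def q(2))
        then show "ereal s \<le> ereal q" using assms by simp
      qed
      show "ereal q \<le> Sup (ereal ` S)"
      proof (rule dense_le)
        fix y assume y: "y < ereal q"
        show "y \<le> Sup (ereal ` S)"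
        proof (cases y)
          case (real s)
          then have "(1 - \<theta>) * s < p" using y assms by (simp add: q)
          then have "covering_growth X \<theta> ((1 - \<theta>) * max s 0)"
            using R by (cases "s \<ge> 0") (auto simp: max_def intro: covering_growth_nonpos)
          then have "max s 0 \<in> S" by (simp add: S_def)
          then have "ereal (max s 0) \<le> Sup (ereal ` S)" by (intro SUP_upper)
          then show ?thesis using real by (meson ereal_less_eq(3) max.cobounded1 order_trans)
        qed (use y in auto)
      qed
    qed
  qed
  finally show ?thesis .
qed

text \<open>
  For \<open>\<theta> = 1\<close> the ball \<open>B(x, r)\<close> is covered by itself. This gives the convention that the scaled
  spectrum vanishes at 1 the same description as the other values.
\<close>

lemma covering_growth_one_iff:
  assumes "X \<noteq> {}"
  shows "covering_growth X 1 t \<longleftrightarrow> t \<le> 0"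
proof
  assume "covering_growth X 1 t"
  then obtain C where C: "C > 0"
    "\<And>r x A. 0 < r \<Longrightarrow> r < 1 \<Longrightarrow> x \<in> X \<Longrightarrow> is_cover X r (rel_cball X x (r powr 1)) A
       \<Longrightarrow> C * r powr (-t) \<le> real (card A)"
    unfolding covering_growth_def by blast
  obtain x where x: "x \<in> X" using assms by blast
  show "t \<le> 0"
  proof (rule ccontr)
    assume t: "\<not> t \<le> 0"
    define r where "r = min (1/2) ((C/2) powr (1/t))"
    have r: "0 < r" "r < 1" using C(1) by (auto simp: r_def)
    have "is_cover X r (rel_cball X x (r powr 1)) {x}"
      using r x by (auto simp: is_cover_def)
    from C(2)[OF r x this] have "C * r powr (-t) \<le> 1" by simp
    then have "C \<le> r powr t" using r by (simp add: powr_minus field_simps)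
    also have "\<dots> \<le> ((C/2) powr (1/t)) powr t" using r t by (intro powr_mono2) (auto simp: r_def)
    also have "\<dots> = C/2" using C(1) t by (simp add: powr_powr)
    finally show False using C(1) by simp
  qed
qed (rule covering_growth_nonpos)

text \<open>
  Only small radii matter, since for \<open>r \<ge> r0\<close> the bound follows from covers being nonempty, after
  decreasing the constant.
\<close>

lemma covering_growthI_small:
  assumes "0 < r0" "r0 < 1" "0 < C"
    and "\<And>r x A. 0 < r \<Longrightarrow> r \<le> r0 \<Longrightarrow> x \<in> X \<Longrightarrow> is_cover X r (rel_cball X x (r powr \<theta>)) A
       \<Longrightarrow> C * r powr (-t) \<le> real (card A)"
  shows "covering_growth X \<theta> t"
proof (cases "t \<le> 0")
  case False
  define C' where "C' = min C (r0 powr t)"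
  have "C' * r powr (-t) \<le> real (card A)"
    if "0 < r" "r < 1" "x \<in> X" "is_cover X r (rel_cball X x (r powr \<theta>)) A" for r x A
  proof (cases "r \<le> r0")
    case True
    have "C' * r powr (-t) \<le> C * r powr (-t)" by (intro mult_right_mono) (auto simp: C'_def)
    then show ?thesis using assms(4)[OF that(1) True that(3,4)] by linarith
  next
    assume r: "\<not> r \<le> r0"
    have "C' * r powr (-t) \<le> r0 powr t * r0 powr (-t)"
      using r assms False by (intro mult_mono powr_mono2') (auto simp: C'_def)
    also have "\<dots> = 1" using assms by (simp add: powr_minus)
    also have "\<dots> \<le> real (card A)" using is_cover_card_ge_1[OF that(4,3)] by simp
    finally show ?thesis .
  qed
  moreover have "C' > 0" using assms by (simp add: C'_def)
  ultimately show ?thesis unfolding covering_growth_def by blast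
qed (rule covering_growth_nonpos)

section \<open>Covers and separated nets in Euclidean space\<close>

text \<open>
  Cut the cube around \<open>cball x R\<close> into cells of side \<open>r / CARD('n)\<close>, so that cells have diameter at
  most \<open>r\<close>, and choose one point of \<open>X\<close> in every cell that meets \<open>X \<inter> cball x R\<close>. Choosing points
  of \<open>X\<close>, rather than cell midpoints, is needed because covers must have their centres in \<open>X\<close>.
\<close>

lemma euclidean_ball_cover:
  fixes X :: "(real^'n) set"
  assumes "0 < r" "r \<le> R"
  obtains A where "is_cover X r (X \<inter> cball x R) A" "A \<subseteq> cball x R"
    "real (card A) \<le> (4 * real CARD('n)) ^ CARD('n) * (R / r) ^ CARD('n)"
proof -
  define D where "D = real CARD('n)"
  have D: "1 \<le> D" by (simp add: D_def Suc_le_eq)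
  define cell where "cell y = (\<lambda>i. \<lfloor>(y $ i - x $ i) * D / r\<rfloor>)" for y :: "real^'n"
  define b where "b = \<lfloor>R * D / r\<rfloor>"
  define T where "T = (UNIV \<rightarrow>\<^sub>E {-b-1..b} :: ('n \<Rightarrow> int) set)"
  define E where "E = X \<inter> cball x R"
  define rep where "rep = (\<lambda>c. SOME y. y \<in> E \<and> cell y = c)"
  define A where "A = rep ` (cell ` E)"
  have "cell y \<in> T" if "y \<in> E" for y
  proof -
    have "cell y i \<in> {-b-1..b}" for i
    proof -
      have "\<bar>y $ i - x $ i\<bar> \<le> R"
        using that component_le_norm_cart[of "y - x" i] by (simp add: E_def dist_norm norm_minus_commute)
      then have "\<bar>y $ i - x $ i\<bar> * (D / r) \<le> R * (D / r)"
        using assms D by (intro mult_right_mono) auto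
      then have *: "(y $ i - x $ i) * D / r \<le> R * D / r" "- (R * D / r) \<le> (y $ i - x $ i) * D / r"
      proof -
        have "\<bar>(y $ i - x $ i) * (D / r)\<bar> \<le> R * (D / r)"
          using \<open>\<bar>y $ i - x $ i\<bar> * (D / r) \<le> R * (D / r)\<close> assms D by (simp add: abs_mult)
        then show "(y $ i - x $ i) * D / r \<le> R * D / r" "- (R * D / r) \<le> (y $ i - x $ i) * D / r"
          by (simp_all only: abs_le_iff times_divide_eq_right) linarith
      qed
      have "\<lfloor>- (R * D / r)\<rfloor> \<ge> - b - 1" unfolding b_def by linarith
      with floor_mono[OF *(1)] floor_mono[OF *(2)] show ?thesis
        by (simp add: cell_def b_def)
    qed
    then show ?thesis by (auto simp: T_def)
  qed
  then have sub: "cell ` E \<subseteq> T" by blast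
  have finT: "finite T" by (auto simp: T_def intro: finite_PiE)
  have b0: "0 \<le> b" using assms D by (simp add: b_def)
  have "card A \<le> card T"
    unfolding A_def by (meson card_image_le card_mono finT finite_subset order_trans sub)
  also have "card T = nat (2 * b + 2) ^ CARD('n)"
    using b0 by (simp add: T_def card_funcsetE add.commute)
  finally have "real (card A) \<le> real (nat (2 * b + 2) ^ CARD('n))" by (simp only: of_nat_le_iff)
  also have "\<dots> = (2 * real_of_int b + 2) ^ CARD('n)" using b0 by simp
  also have "\<dots> \<le> (4 * D * (R / r)) ^ CARD('n)"
  proof (rule power_mono)
    have "real_of_int b \<le> D * (R / r)" by (simp add: b_def mult.commute)
    moreover have "1 * 1 \<le> D * (R / r)" using assms D by (intro mult_mono) auto
    ultimately show "2 * real_of_int b + 2 \<le> 4 * D * (R / r)" by linarith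
  qed (use b0 in auto)
  finally have card: "real (card A) \<le> (4 * D) ^ CARD('n) * (R / r) ^ CARD('n)"
    by (simp only: power_mult_distrib)
  have rep: "rep (cell y) \<in> E" "cell (rep (cell y)) = cell y" if "y \<in> E" for y
    using someI[of "\<lambda>z. z \<in> E \<and> cell z = cell y" y] that by (auto simp: rep_def)
  have "E \<subseteq> (\<Union>a\<in>A. rel_cball X a r)"
  proof
    fix y assume y: "y \<in> E"
    define z where "z = rep (cell y)"
    have "\<bar>(z - y) $ i\<bar> \<le> r / D" for i
    proof -
      have "\<lfloor>(z $ i - x $ i) * D / r\<rfloor> = \<lfloor>(y $ i - x $ i) * D / r\<rfloor>"
        using rep(2)[OF y] by (simp add: z_def cell_def fun_eq_iff)
      then have "\<bar>(z $ i - x $ i) * D / r - (y $ i - x $ i) * D / r\<bar> \<le> 1" by linarith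
      also have "(z $ i - x $ i) * D / r - (y $ i - x $ i) * D / r = (z - y) $ i * (D / r)"
        by (simp add: diff_divide_distrib left_diff_distrib)
      finally have "\<bar>(z - y) $ i\<bar> * \<bar>D / r\<bar> \<le> 1" by (simp only: abs_mult)
      then have "\<bar>(z - y) $ i\<bar> * D \<le> r" using assms D by (simp add: pos_divide_le_eq)
      then show ?thesis using D by (simp add: pos_le_divide_eq)
    qed
    then have "(\<Sum>i\<in>UNIV. \<bar>(z - y) $ i\<bar>) \<le> (\<Sum>i\<in>(UNIV::'n set). r / D)" by (intro sum_mono)
    then have "norm (z - y) \<le> r"
      using norm_le_l1_cart[of "z - y"] D by (simp add: D_def)
    then have "y \<in> rel_cball X z r" using y by (simp add: rel_cball_def E_def dist_norm)
    then show "y \<in> (\<Union>a\<in>A. rel_cball X a r)" using y by (auto simp: A_def z_def)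
  qed
  moreover have "A \<subseteq> E" using rep(1) by (auto simp: A_def)
  moreover have "finite A" unfolding A_def using finite_subset[OF sub finT] by simp
  ultimately show thesis using card by (intro that[of A]) (auto simp: is_cover_def E_def D_def)
qed

lemma is_cover_refine:
  fixes X :: "(real^'n) set"
  assumes "is_cover X R E A" "0 < r" "r \<le> R"
  obtains A' where "is_cover X r E A'"
    "real (card A') \<le> (4 * real CARD('n)) ^ CARD('n) * (R / r) ^ CARD('n) * real (card A)"
proof -
  define M where "M = (4 * real CARD('n)) ^ CARD('n) * (R / r) ^ CARD('n)"
  have "\<exists>B. is_cover X r (X \<inter> cball a R) B \<and> real (card B) \<le> M" for a
    unfolding M_def using euclidean_ball_cover[OF assms(2,3)] by metis
  then obtain B where B: "\<And>a. is_cover X r (X \<inter> cball a R) (B a)" "\<And>a. real (card (B a)) \<le> M"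
    by metis
  have A: "finite A" "E \<subseteq> (\<Union>a\<in>A. X \<inter> cball a R)"
    using assms(1) by (auto simp: is_cover_def rel_cball_def)
  have "real (card (\<Union>a\<in>A. B a)) \<le> (\<Sum>a\<in>A. real (card (B a)))"
    using card_UN_le[OF A(1), of B] by (metis of_nat_le_iff of_nat_sum)
  also have "\<dots> \<le> (\<Sum>a\<in>A. M)" by (intro sum_mono B)
  finally have "real (card (\<Union>a\<in>A. B a)) \<le> M * real (card A)" by (simp add: mult.commute)
  moreover have "is_cover X r E (\<Union>a\<in>A. B a)"
    unfolding is_cover_def
  proof (intro conjI)
    show "finite (\<Union>a\<in>A. B a)" "(\<Union>a\<in>A. B a) \<subseteq> X"
      using A(1) B(1) by (auto simp: is_cover_def)
    have "E \<subseteq> (\<Union>a\<in>A. \<Union>b\<in>B a. rel_cball X b r)"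
      using A(2) B(1) unfolding is_cover_def by (meson UN_mono order_refl order_trans)
    then show "E \<subseteq> (\<Union>b\<in>\<Union>a\<in>A. B a. rel_cball X b r)" by simp
  qed
  ultimately show thesis by (intro that) (auto simp: M_def)
qed

text \<open>
  A maximal separated subset of a finite \<open>\<epsilon>\<close>-cover is finite without further argument; the
  price is that it is a \<open>5\<epsilon>\<close>-net instead of a \<open>4\<epsilon>\<close>-net.
\<close>

lemma exists_separated_net:
  fixes X :: "(real^'n) set"
  assumes "0 < \<epsilon>" "\<epsilon> \<le> R"
  obtains S where "is_cover X (5 * \<epsilon>) (X \<inter> cball x R) S" "S \<subseteq> cball x R"
    "\<And>a b. a \<in> S \<Longrightarrow> b \<in> S \<Longrightarrow> a \<noteq> b \<Longrightarrow> 4 * \<epsilon> < dist a b"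
proof -
  obtain B where B: "is_cover X \<epsilon> (X \<inter> cball x R) B" "B \<subseteq> cball x R"
    using euclidean_ball_cover[OF assms] by blast
  define sep where "sep S \<longleftrightarrow> (\<forall>a\<in>S. \<forall>b\<in>S. a \<noteq> b \<longrightarrow> 4 * \<epsilon> < dist a b)" for S :: "(real^'n) set"
  have "finite B" using B by (simp add: is_cover_def)
  moreover have "sep {}" by (simp add: sep_def)
  ultimately obtain S where S: "S \<subseteq> B" "sep S" "\<And>S'. S' \<subseteq> B \<Longrightarrow> sep S' \<Longrightarrow> S \<subseteq> S' \<Longrightarrow> S' = S"
    using finite_has_maximal[of "{S. S \<subseteq> B \<and> sep S}"] by simp (metis empty_subsetI)
  have near: "\<exists>a\<in>S. dist a b \<le> 4 * \<epsilon>" if "b \<in> B" for b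
  proof (rule ccontr)
    assume far: "\<not> ?thesis"
    then have "sep (insert b S)" using S(2) by (auto simp: sep_def dist_commute not_le)
    then have "insert b S = S" using S that by (intro S(3)) auto
    then have "b \<in> S" by blast
    then show False using far assms by auto
  qed
  have "X \<inter> cball x R \<subseteq> (\<Union>a\<in>S. rel_cball X a (5 * \<epsilon>))"
  proof
    fix y assume y: "y \<in> X \<inter> cball x R"
    then obtain b where b: "b \<in> B" "dist b y \<le> \<epsilon>" using B by (auto simp: is_cover_def rel_cball_def)
    obtain a where a: "a \<in> S" "dist a b \<le> 4 * \<epsilon>" using near[OF b(1)] by blast
    have "dist a y \<le> 5 * \<epsilon>" using dist_triangle[of a y b] a b by linarith
    then show "y \<in> (\<Union>a\<in>S. rel_cball X a (5 * \<epsilon>))" using a y by (auto simp: rel_cball_def)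
  qed
  then show thesis
    using S B \<open>finite B\<close> by (intro that[of S]) (auto simp: is_cover_def sep_def intro: finite_subset)
qed


section \<open>Necessity of the inequalities\<close>

text \<open>
  With \<open>r2 = r powr \<theta>\<close> and \<open>r3 = r powr (\<mu> * \<theta>)\<close>, take a separated \<open>r2\<close>-net \<open>S\<close> of the ball of
  radius \<open>r3 / 2\<close>. Every \<open>r2\<close>-ball around a point of \<open>S\<close> lies in the \<open>r3\<close>-ball, and a ball of a
  cover at scale \<open>r\<close> meets at most one of them, so the cover has at least \<open>card S\<close> times
  \<open>r powr (-t)\<close> elements. The size of \<open>S\<close> is bounded below by the growth at \<open>\<mu>\<close>.
\<close>

lemma covering_growth_mult:
  fixes X :: "(real^'n) set"
  assumes \<theta>: "0 < \<theta>" "\<theta> < 1" and \<mu>: "0 < \<mu>" "\<mu> < 1"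
    and t: "covering_growth X \<theta> t" and u: "covering_growth X \<mu> u"
  shows "covering_growth X (\<mu> * \<theta>) (t + \<theta> * u)"
proof -
  obtain C1 where C1: "C1 > 0"
    "\<And>r x A. 0 < r \<Longrightarrow> r < 1 \<Longrightarrow> x \<in> X \<Longrightarrow> is_cover X r (rel_cball X x (r powr \<theta>)) A
       \<Longrightarrow> C1 * r powr (-t) \<le> real (card A)"
    using t unfolding covering_growth_def by blast
  obtain C2 where C2: "C2 > 0"
    "\<And>r x A. 0 < r \<Longrightarrow> r < 1 \<Longrightarrow> x \<in> X \<Longrightarrow> is_cover X r (rel_cball X x (r powr \<mu>)) A
       \<Longrightarrow> C2 * r powr (-u) \<le> real (card A)"
    using u unfolding covering_growth_def by blast
  \<comment> \<open>Chosen so that \<open>(q * r2) powr \<mu> = r3 / 2\<close>: the growth at \<open>\<mu>\<close> is used at scale \<open>q * r2\<close>.\<close>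
  define q where "q = (1/2::real) powr (1/\<mu>)"
  have q: "0 < q" "q < 1" "q powr \<mu> = 1/2"
    using \<mu> by (auto simp: q_def powr_powr powr01_less_one)
  define M where "M = (4 * real CARD('n)) ^ CARD('n) * (5 / q) ^ CARD('n)"
  have M: "M > 0" using q by (simp add: M_def)
  \<comment> \<open>Below this threshold \<open>r2 \<le> r3 / 2\<close>.\<close>
  define r0 where "r0 = (1/2 :: real) powr (1 / (\<theta> * (1 - \<mu>)))"
  have r0: "0 < r0" "r0 < 1" using \<theta> \<mu> by (auto simp: r0_def powr01_less_one)
  show ?thesis
  proof (rule covering_growthI_small[OF r0])
    show "C1 * (C2 * q powr (-u) / M) > 0" using C1 C2 q M by simp
    fix r x A
    assume r: "0 < r" "r \<le> r0" and x: "x \<in> X"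
      and A: "is_cover X r (rel_cball X x (r powr (\<mu> * \<theta>))) A"
    have r1: "r < 1" using r r0 by linarith
    define r2 where "r2 = r powr \<theta>"
    define r3 where "r3 = r powr (\<mu> * \<theta>)"
    have r2: "0 < r2" "r2 < 1" "r \<le> r2"
      using r r1 \<theta> powr_mono'[of \<theta> 1 r] by (auto simp: r2_def powr01_less_one)
    have r3: "r3 = r2 powr \<mu>" by (simp add: r2_def r3_def powr_powr mult.commute)
    have r23: "r2 \<le> r3 / 2"
    proof -
      have "r2 = r3 * r powr (\<theta> * (1 - \<mu>))"
        by (simp add: r2_def r3_def powr_add[symmetric] algebra_simps)
      also have "r powr (\<theta> * (1 - \<mu>)) \<le> r0 powr (\<theta> * (1 - \<mu>))"
        using r \<theta> \<mu> by (intro powr_mono2) auto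
      also have "r0 powr (\<theta> * (1 - \<mu>)) = 1/2" using \<theta> \<mu> by (simp add: r0_def powr_powr)
      finally show ?thesis using r by (simp add: r3_def)
    qed
    obtain S where S: "is_cover X (5 * r2) (X \<inter> cball x (r3/2)) S" "S \<subseteq> cball x (r3/2)"
      "\<And>a b. a \<in> S \<Longrightarrow> b \<in> S \<Longrightarrow> a \<noteq> b \<Longrightarrow> 4 * r2 < dist a b"
      using exists_separated_net[OF r2(1) r23] by blast
    have finS: "finite S" "S \<subseteq> X" using S by (auto simp: is_cover_def)
    have finA: "finite A" "A \<subseteq> X" using A by (auto simp: is_cover_def)
    define \<rho> where "\<rho> = q * r2"
    have \<rho>: "0 < \<rho>" "\<rho> < 1" "\<rho> \<le> 5 * r2"
      using q r2 mult_strict_mono[of q 1 r2 1] mult_right_mono[of q 1 r2] by (auto simp: \<rho>_def)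
    have "\<rho> powr \<mu> = r3 / 2" using q r2 by (simp add: \<rho>_def powr_mult r3)
    obtain S' where S': "is_cover X \<rho> (X \<inter> cball x (r3/2)) S'" "real (card S') \<le> M * real (card S)"
    proof -
      have "5 * r2 / \<rho> = 5 / q" using r2 by (simp add: \<rho>_def)
      then show thesis
        using is_cover_refine[OF S(1) \<rho>(1,3)] that unfolding M_def by metis
    qed
    have "C2 * \<rho> powr (-u) \<le> real (card S')"
    proof (rule C2(2)[OF \<rho>(1,2) x])
      show "is_cover X \<rho> (rel_cball X x (\<rho> powr \<mu>)) S'"
        using S'(1) unfolding rel_cball_def \<open>\<rho> powr \<mu> = r3 / 2\<close> by (subst Int_commute)
    qed
    also have "\<dots> \<le> M * real (card S)" by (rule S')
    also have "\<rho> powr (-u) = q powr (-u) * r powr (- (\<theta> * u))"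
      using q r2 by (simp add: \<rho>_def powr_mult r2_def powr_powr)
    finally have cardS: "C2 * q powr (-u) / M * r powr (- (\<theta> * u)) \<le> real (card S)"
      using M by (simp add: pos_divide_le_eq mult_ac)
    define N where "N a = {c\<in>A. \<exists>y\<in>X. dist a y \<le> r2 \<and> dist c y \<le> r}" for a
    have disj: "N a \<inter> N b = {}" if "a \<in> S" "b \<in> S" "a \<noteq> b" for a b
    proof (rule ccontr)
      assume "N a \<inter> N b \<noteq> {}"
      then obtain c y z where c: "dist a y \<le> r2" "dist c y \<le> r" "dist b z \<le> r2" "dist c z \<le> r"
        by (auto simp: N_def)
      have "dist a b \<le> dist a y + dist c y + dist c z + dist b z"
        using dist_triangle[of a b c] dist_triangle[of a c y] dist_triangle[of c b z]
        by (simp add: dist_commute)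
      also have "\<dots> \<le> 4 * r2" using c r2 by linarith
      finally show False using S(3)[OF that] by simp
    qed
    have cardN: "C1 * r powr (-t) \<le> real (card (N a))" if a: "a \<in> S" for a
    proof (rule C1(2)[OF r(1) r1])
      show "a \<in> X" using a finS by blast
      have ball: "rel_cball X a r2 \<subseteq> rel_cball X x r3"
      proof
        fix y assume "y \<in> rel_cball X a r2"
        then have "dist a y \<le> r3 / 2" "y \<in> X" using r23 by (auto simp: rel_cball_def)
        moreover have "dist x a \<le> r3 / 2" using a S(2) by auto
        ultimately show "y \<in> rel_cball X x r3"
          using dist_triangle[of x y a] by (simp add: rel_cball_def)
      qed
      have "rel_cball X a r2 \<subseteq> (\<Union>c\<in>N a. rel_cball X c r)"
      proof
        fix y assume y: "y \<in> rel_cball X a r2"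
        then have "y \<in> rel_cball X x r3" using ball by blast
        then obtain c where "c \<in> A" "y \<in> rel_cball X c r" using A by (auto simp: is_cover_def r3_def)
        then show "y \<in> (\<Union>c\<in>N a. rel_cball X c r)" using y by (auto simp: N_def rel_cball_def)
      qed
      then show "is_cover X r (rel_cball X a (r powr \<theta>)) (N a)"
        using finA by (auto simp: is_cover_def r2_def N_def)
    qed
    have "C1 * (C2 * q powr (-u) / M) * r powr (- (t + \<theta> * u))
        = (C2 * q powr (-u) / M * r powr (- (\<theta> * u))) * (C1 * r powr (-t))"
    proof -
      have "r powr (- (t + \<theta> * u)) = r powr (- (\<theta> * u)) * r powr (-t)"
        by (simp add: powr_add[symmetric] algebra_simps)
      then show ?thesis by (simp only: mult_ac times_divide_eq_left)
    qed
    also have "\<dots> \<le> real (card S) * (C1 * r powr (-t))"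
      using cardS C1 by (intro mult_right_mono) auto
    also have "\<dots> = (\<Sum>a\<in>S. C1 * r powr (-t))" by simp
    also have "\<dots> \<le> (\<Sum>a\<in>S. real (card (N a)))" by (intro sum_mono cardN)
    also have "\<dots> = real (card (\<Union>a\<in>S. N a))"
      using finS finA disj by (subst card_UN_disjoint) (auto simp: N_def)
    also have "\<dots> \<le> real (card A)"
      using finA by (intro of_nat_mono card_mono) (auto simp: N_def)
    finally show "C1 * (C2 * q powr (-u) / M) * r powr (- (t + \<theta> * u)) \<le> real (card A)" .
  qed
qed

text \<open>
  A cover at scale \<open>\<rho> = r powr \<theta>\<close> refines to a cover at scale \<open>r\<close> with, up to a
  constant factor, at most \<open>(\<rho> / r) ^ CARD('n)\<close> times as many elements, so a lower bound at scale \<open>r\<close> gives one at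
  scale \<open>\<rho>\<close>.
\<close>

lemma covering_growth_div:
  fixes X :: "(real^'n) set"
  assumes \<theta>: "0 < \<theta>" "\<theta> \<le> 1" and t: "covering_growth X (\<mu> * \<theta>) t"
  shows "covering_growth X \<mu> ((t - (1 - \<theta>) * real CARD('n)) / \<theta>)"
proof -
  define D where "D = real CARD('n)"
  define M where "M = (4 * D) ^ CARD('n)"
  have M: "M > 0" by (simp add: M_def D_def)
  obtain C where C: "C > 0"
    "\<And>r x A. 0 < r \<Longrightarrow> r < 1 \<Longrightarrow> x \<in> X \<Longrightarrow> is_cover X r (rel_cball X x (r powr (\<mu> * \<theta>))) A
       \<Longrightarrow> C * r powr (-t) \<le> real (card A)"
    using t unfolding covering_growth_def by blast
  have "C / M * \<rho> powr (- ((t - (1 - \<theta>) * D) / \<theta>)) \<le> real (card A)"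
    if \<rho>: "0 < \<rho>" "\<rho> < 1" and x: "x \<in> X" and A: "is_cover X \<rho> (rel_cball X x (\<rho> powr \<mu>)) A" for \<rho> x A
  proof -
    define r where "r = \<rho> powr (1/\<theta>)"
    have r: "0 < r" "r < 1" "r \<le> \<rho>" "\<rho> = r powr \<theta>"
      using \<rho> \<theta> powr_mono'[of 1 "1/\<theta>" \<rho>] by (auto simp: r_def powr01_less_one powr_powr)
    obtain A' where A': "is_cover X r (rel_cball X x (\<rho> powr \<mu>)) A'"
      "real (card A') \<le> M * (\<rho> / r) ^ CARD('n) * real (card A)"
      using is_cover_refine[OF A r(1,3)] unfolding M_def D_def by metis
    have "\<rho> powr \<mu> = r powr (\<mu> * \<theta>)" using r by (simp add: powr_powr mult.commute)
    then have "C * r powr (-t) \<le> real (card A')" using A'(1) by (intro C(2)[OF r(1,2) x]) simp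
    also have "\<dots> \<le> M * (\<rho> / r) ^ CARD('n) * real (card A)" by (rule A')
    also have "(\<rho> / r) ^ CARD('n) = r powr (- ((1 - \<theta>) * D))"
    proof -
      have "\<rho> / r = r powr (\<theta> - 1)" using r by (simp add: powr_diff)
      then show ?thesis using r by (simp add: powr_realpow[symmetric] powr_powr D_def algebra_simps)
    qed
    finally have "C * r powr (-t) * r powr ((1 - \<theta>) * D)
        \<le> M * r powr (- ((1 - \<theta>) * D)) * real (card A) * r powr ((1 - \<theta>) * D)"
      by (intro mult_right_mono) auto
    also have "\<dots> = M * real (card A) * (r powr (- ((1 - \<theta>) * D)) * r powr ((1 - \<theta>) * D))"
      by (simp only: mult_ac)
    also have "r powr (- ((1 - \<theta>) * D)) * r powr ((1 - \<theta>) * D) = 1"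
      using r by (simp add: powr_add[symmetric])
    finally have "C * (r powr (-t) * r powr ((1 - \<theta>) * D)) \<le> M * real (card A)"
      by (simp add: mult.assoc)
    also have "r powr (-t) * r powr ((1 - \<theta>) * D) = r powr (- (t - (1 - \<theta>) * D))"
      by (simp add: powr_add[symmetric])
    also have "\<dots> = \<rho> powr (- ((t - (1 - \<theta>) * D) / \<theta>))"
      unfolding r_def by (simp add: powr_powr minus_divide_left)
    finally show ?thesis using M by (simp add: pos_divide_le_eq mult_ac)
  qed
  moreover have "C / M > 0" using C M by simp
  ultimately show ?thesis unfolding covering_growth_def D_def by blast
qed

text \<open>
  The growth lemmas are applied to exponents slightly below the critical ones. If \<open>\<mu> = 1\<close> or
  \<open>\<theta> = 1\<close>, two of the three scales coincide, and the first inequality reduces to \<open>\<phi> 1 = 0\<close>.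
\<close>

lemma spectrum_inequalities:
  fixes F :: "(real^'n) set" and \<phi> :: "real \<Rightarrow> real"
  assumes F: "F \<noteq> {}"
    and spec: "\<And>\<theta>. 0 < \<theta> \<Longrightarrow> \<theta> \<le> 1 \<Longrightarrow> scaled_lower_spectrum \<theta> F = ereal (\<phi> \<theta>)"
    and nonneg: "\<And>\<theta>. 0 < \<theta> \<Longrightarrow> \<theta> \<le> 1 \<Longrightarrow> 0 \<le> \<phi> \<theta>"
    and \<mu>: "0 < \<mu>" "\<mu> \<le> 1" and \<theta>: "0 < \<theta>" "\<theta> \<le> 1"
  shows "\<phi> \<theta> \<le> \<phi> (\<mu> * \<theta>) - \<theta> * \<phi> \<mu>"
    and "\<phi> (\<mu> * \<theta>) - \<theta> * \<phi> \<mu> \<le> (1 - \<theta>) * real CARD('n)"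
proof -
  have one: "\<phi> 1 = 0" using spec[of 1] by (simp add: scaled_lower_spectrum_def)
  have growth: "(\<forall>t<\<phi> \<theta>. covering_growth F \<theta> t) \<and> (\<forall>t. covering_growth F \<theta> t \<longrightarrow> t \<le> \<phi> \<theta>)"
    if "0 < \<theta>" "\<theta> \<le> 1" for \<theta>
  proof (cases "\<theta> = 1")
    case True
    then show ?thesis using F one by (simp add: covering_growth_one_iff)
  next
    case False
    then show ?thesis
      using that scaled_lower_spectrum_eq_iff[of \<theta> "\<phi> \<theta>" F] spec[of \<theta>] nonneg[of \<theta>] by simp
  qed
  have \<mu>\<theta>: "0 < \<mu> * \<theta>" "\<mu> * \<theta> \<le> 1" using \<mu> \<theta> mult_le_one[of \<mu> \<theta>] by auto
  have "\<phi> \<theta> + \<theta> * \<phi> \<mu> \<le> \<phi> (\<mu> * \<theta>)"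
  proof (cases "\<mu> < 1 \<and> \<theta> < 1")
    case True
    show ?thesis
    proof (rule field_le_epsilon)
      fix e :: real assume e: "0 < e"
      have "covering_growth F (\<mu> * \<theta>) ((\<phi> \<theta> - e/2) + \<theta> * (\<phi> \<mu> - e/2))"
        using growth[of \<theta>] growth[of \<mu>] True \<mu> \<theta> e by (intro covering_growth_mult) auto
      then have "(\<phi> \<theta> - e/2) + \<theta> * (\<phi> \<mu> - e/2) \<le> \<phi> (\<mu> * \<theta>)" using growth[OF \<mu>\<theta>] by blast
      moreover have "\<theta> * (e/2) \<le> e/2" using \<theta> e by simp
      ultimately show "\<phi> \<theta> + \<theta> * \<phi> \<mu> \<le> \<phi> (\<mu> * \<theta>) + e" by (simp add: right_diff_distrib)
    qed
  next
    case False
    then have "\<mu> = 1 \<or> \<theta> = 1" using \<mu> \<theta> by linarith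
    then show ?thesis using one by auto
  qed
  then show "\<phi> \<theta> \<le> \<phi> (\<mu> * \<theta>) - \<theta> * \<phi> \<mu>" by simp
  have "t \<le> \<theta> * \<phi> \<mu> + (1 - \<theta>) * real CARD('n)" if "t < \<phi> (\<mu> * \<theta>)" for t
  proof -
    have "covering_growth F \<mu> ((t - (1 - \<theta>) * real CARD('n)) / \<theta>)"
      using growth[OF \<mu>\<theta>] that \<theta> by (intro covering_growth_div) auto
    then have "(t - (1 - \<theta>) * real CARD('n)) / \<theta> \<le> \<phi> \<mu>" using growth[OF \<mu>] by blast
    then show ?thesis using \<theta> by (simp add: pos_divide_le_eq algebra_simps)
  qed
  then have "\<phi> (\<mu> * \<theta>) \<le> \<theta> * \<phi> \<mu> + (1 - \<theta>) * real CARD('n)" by (rule dense_le)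
  then show "\<phi> (\<mu> * \<theta>) - \<theta> * \<phi> \<mu> \<le> (1 - \<theta>) * real CARD('n)" by simp
qed

section \<open>Sets with prescribed free binary digits\<close>

definition digit_sum :: "nat set \<Rightarrow> real" where
  "digit_sum A = (\<Sum>j\<in>A. (1/2) ^ j)"

lemma digit_sum_Un_disjoint:
  assumes "finite A" "finite B" "A \<inter> B = {}"
  shows "digit_sum (A \<union> B) = digit_sum A + digit_sum B"
  using assms by (simp add: digit_sum_def sum.union_disjoint)

lemma digit_sum_mono:
  assumes "finite B" "A \<subseteq> B"
  shows "digit_sum A \<le> digit_sum B"
  unfolding digit_sum_def using assms by (intro sum_mono2) auto

lemma digit_sum_nonneg: "0 \<le> digit_sum A"
  by (simp add: digit_sum_def sum_nonneg)

lemma digit_sum_interval: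
  assumes "s \<le> t"
  shows "digit_sum {s<..t} = (1/2) ^ s - (1/2) ^ t"
  using assms
proof (induction t rule: dec_induct)
  case (step t)
  then have "{s<..Suc t} = insert (Suc t) {s<..t}" by auto
  then show ?case using step.IH by (simp add: digit_sum_def)
qed (simp add: digit_sum_def)

lemma digit_sum_less:
  assumes "finite A" "A \<subseteq> {s<..}"
  shows "digit_sum A < (1/2) ^ s"
proof -
  define t where "t = Max (insert s A)"
  have "A \<subseteq> {s<..t}" "s \<le> t" using assms by (auto simp: t_def)
  then have "digit_sum A \<le> (1/2) ^ s - (1/2) ^ t"
    using digit_sum_mono[of "{s<..t}" A] by (simp add: digit_sum_interval)
  also have "\<dots> < (1/2) ^ s" by simp
  finally show ?thesis .
qed

text \<open>
  At the first place \<open>m\<close> where the digits differ, the set containing \<open>m\<close> gains \<open>(1/2) ^ m\<close>, while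
  the other set can recover at most \<open>digit_sum {m<..t} = (1/2) ^ m - (1/2) ^ t\<close> from later places.
\<close>

lemma digit_sum_separated:
  assumes "A \<subseteq> {..t}" "B \<subseteq> {..t}" "A \<noteq> B"
  shows "(1/2) ^ t \<le> \<bar>digit_sum A - digit_sum B\<bar>"
proof -
  have *: "(1/2) ^ t \<le> digit_sum A - digit_sum B"
    if AB: "A \<subseteq> {..t}" "B \<subseteq> {..t}" and m: "m \<in> A" "m \<notin> B" and low: "A \<inter> {..<m} = B \<inter> {..<m}"
    for A B m
  proof -
    have fin: "finite A" "finite B" using AB finite_subset by blast+
    have "m \<le> t" using AB m by auto
    have "digit_sum B \<le> digit_sum (A \<inter> {..<m} \<union> {m<..t})"
    proof (rule digit_sum_mono)
      show "B \<subseteq> A \<inter> {..<m} \<union> {m<..t}"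
      proof
        fix j assume "j \<in> B"
        then show "j \<in> A \<inter> {..<m} \<union> {m<..t}"
          using AB m low by (cases j m rule: linorder_cases) auto
      qed
    qed (use fin in auto)
    also have "\<dots> = digit_sum (A \<inter> {..<m}) + ((1/2) ^ m - (1/2) ^ t)"
      using fin \<open>m \<le> t\<close> by (subst digit_sum_Un_disjoint) (auto simp: digit_sum_interval)
    also have "digit_sum (A \<inter> {..<m}) + (1/2) ^ m = digit_sum (insert m (A \<inter> {..<m}))"
      using fin by (simp add: digit_sum_def)
    then have "digit_sum (A \<inter> {..<m}) + ((1/2) ^ m - (1/2) ^ t)
        = digit_sum (insert m (A \<inter> {..<m})) - (1/2) ^ t" by simp
    also have "\<dots> \<le> digit_sum A - (1/2) ^ t"
      using digit_sum_mono[of A "insert m (A \<inter> {..<m})"] fin m by simp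
    finally show ?thesis by simp
  qed
  define P where "P m \<longleftrightarrow> (m \<in> A) \<noteq> (m \<in> B)" for m
  define m where "m = (LEAST m. P m)"
  have ex: "\<exists>m. P m" using assms(3) by (auto simp: P_def)
  have m: "P m" unfolding m_def using ex by (rule LeastI_ex)
  have "\<not> P j" if "j < m" for j using that unfolding m_def by (rule not_less_Least)
  then have low: "A \<inter> {..<m} = B \<inter> {..<m}" by (auto simp: P_def)
  show ?thesis
  proof (cases "m \<in> A")
    case True
    then show ?thesis using *[OF assms(1,2), of m] m low by (simp add: P_def)
  next
    case False
    then show ?thesis using *[OF assms(2,1), of m] m low by (simp add: P_def)
  qed
qed

text \<open>
  Only finite expansions are used. The resulting sets are not closed, but they are dense in the
  corresponding Cantor sets, and covering numbers do not see the difference up to constants; in return,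
  truncating an expansion stays inside the set.
\<close>

definition digit_set :: "nat set \<Rightarrow> real set" where
  "digit_set J = {digit_sum A | A. finite A \<and> A \<subseteq> J}"

definition digit_cube :: "nat set \<Rightarrow> (real^'n) set" where
  "digit_cube J = {x. \<forall>i. x $ i \<in> digit_set J}"

definition digit_vec :: "('n \<Rightarrow> nat set) \<Rightarrow> real^'n" where
  "digit_vec B = (\<chi> i. digit_sum (B i))"

lemma digit_vec_in_cube:
  assumes "\<And>i. finite (B i)" "\<And>i. B i \<subseteq> J"
  shows "digit_vec B \<in> digit_cube J"
  using assms by (auto simp: digit_vec_def digit_cube_def digit_set_def)

lemma digit_cubeE:
  assumes "x \<in> digit_cube J"
  obtains B where "\<And>i. finite (B i)" "\<And>i. B i \<subseteq> J" "x = digit_vec B"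
proof -
  have "\<forall>i. \<exists>A. finite A \<and> A \<subseteq> J \<and> x $ i = digit_sum A"
    using assms by (auto simp: digit_cube_def digit_set_def)
  then obtain B where "\<forall>i. finite (B i) \<and> B i \<subseteq> J \<and> x $ i = digit_sum (B i)" by metis
  then show thesis by (intro that[of B]) (auto simp: digit_vec_def vec_eq_iff)
qed

lemma digit_cube_component_bounds:
  assumes "x \<in> digit_cube J" "J \<subseteq> {s<..}"
  shows "0 \<le> x $ i" "x $ i < (1/2) ^ s"
proof -
  obtain A where "finite A" "A \<subseteq> J" "x $ i = digit_sum A"
    using assms(1) by (auto simp: digit_cube_def digit_set_def)
  then show "0 \<le> x $ i" "x $ i < (1/2) ^ s"
    using assms(2) digit_sum_nonneg digit_sum_less[of A s] by auto
qed

lemma zero_in_digit_cube: "0 \<in> digit_cube J"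
  using digit_vec_in_cube[of "\<lambda>_. {}" J] by (simp add: digit_vec_def digit_sum_def zero_vec_def)

lemma dist_le_component_bound:
  fixes x y :: "real^'n"
  assumes "\<And>i. \<bar>x $ i - y $ i\<bar> \<le> c"
  shows "dist x y \<le> real CARD('n) * c"
proof -
  have "dist x y \<le> (\<Sum>i\<in>UNIV. \<bar>(x - y) $ i\<bar>)" unfolding dist_norm by (rule norm_le_l1_cart)
  also have "\<dots> \<le> (\<Sum>i\<in>(UNIV::'n set). c)" using assms by (intro sum_mono) simp
  finally show ?thesis by simp
qed

lemma card_vec_subsets:
  assumes "finite J"
  shows "card (UNIV \<rightarrow>\<^sub>E Pow J :: ('n::finite \<Rightarrow> nat set) set) = 2 ^ (CARD('n) * card J)"
  using assms by (simp add: card_funcsetE card_Pow power_mult[symmetric] mult.commute)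

text \<open>
  Keep the digits of \<open>x\<close> up to place \<open>s\<close> and vary those at the places in \<open>J \<inter> {s<..t}\<close> freely.
  The points obtained stay within distance \<open>R\<close> of \<open>x\<close> and are \<open>(1/2) ^ t\<close>-separated, so no ball of
  radius \<open>r\<close> contains two of them.
\<close>

lemma digit_cube_covering_lower:
  fixes x v :: "real^'n"
  assumes x: "x \<in> digit_cube J" and X: "(+) v ` digit_cube J \<subseteq> X"
    and R: "real CARD('n) * (1/2) ^ s \<le> R" and r: "2 * r < (1/2) ^ t"
    and A: "is_cover X r (rel_cball X (v + x) R) A"
  shows "2 ^ (CARD('n) * card (J \<inter> {s<..t})) \<le> card A"
proof -
  obtain B where B: "\<And>i. finite (B i)" "\<And>i. B i \<subseteq> J" "x = digit_vec B"
    using digit_cubeE[OF x] by blast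
  define T where "T = (UNIV \<rightarrow>\<^sub>E Pow (J \<inter> {s<..t}) :: ('n \<Rightarrow> nat set) set)"
  define pt where "pt f = v + digit_vec (\<lambda>i. B i \<inter> {..s} \<union> f i)" for f
  have T: "f i \<subseteq> J" "f i \<subseteq> {s<..t}" "finite (f i)" if "f \<in> T" for f i
  proof -
    have "f i \<subseteq> J \<inter> {s<..t}" using that by (auto simp: T_def)
    then show "f i \<subseteq> J" "f i \<subseteq> {s<..t}" "finite (f i)" by (auto intro: finite_subset)
  qed
  have split: "digit_sum (B i \<inter> {..s} \<union> f i) = digit_sum (B i \<inter> {..s}) + digit_sum (f i)"
    if "f \<in> T" for f i
    using T[OF that, of i] B(1) by (intro digit_sum_Un_disjoint) auto
  have "pt f \<in> rel_cball X (v + x) R" if f: "f \<in> T" for f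
  proof -
    have "digit_vec (\<lambda>i. B i \<inter> {..s} \<union> f i) \<in> digit_cube J"
      using T[OF f] B(1,2) by (intro digit_vec_in_cube Un_least) (simp_all add: le_infI1)
    then have "pt f \<in> X" using X by (auto simp: pt_def)
    have "dist (v + x) (pt f) \<le> real CARD('n) * (1/2) ^ s"
    proof (rule dist_le_component_bound)
      fix i
      have "digit_sum (B i) = digit_sum (B i \<inter> {..s} \<union> B i \<inter> {s<..})"
        by (rule arg_cong[where f = digit_sum]) auto
      also have "\<dots> = digit_sum (B i \<inter> {..s}) + digit_sum (B i \<inter> {s<..})"
        using B(1) by (intro digit_sum_Un_disjoint) auto
      finally have "(v + x) $ i - pt f $ i = digit_sum (B i \<inter> {s<..}) - digit_sum (f i)"
        using split[OF f] by (simp add: B(3) pt_def digit_vec_def)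
      moreover have "digit_sum (B i \<inter> {s<..}) < (1/2) ^ s" "digit_sum (f i) < (1/2) ^ s"
        using B(1) T[OF f, of i] by (auto intro!: digit_sum_less)
      ultimately show "\<bar>(v + x) $ i - pt f $ i\<bar> \<le> (1/2) ^ s"
        using digit_sum_nonneg[of "f i"] digit_sum_nonneg[of "B i \<inter> {s<..}"] by linarith
    qed
    then show ?thesis using R \<open>pt f \<in> X\<close> by (simp add: rel_cball_def)
  qed
  then have "pt f \<in> (\<Union>a\<in>A. rel_cball X a r)" if "f \<in> T" for f
    using A that unfolding is_cover_def by blast
  then have "\<forall>f\<in>T. \<exists>a\<in>A. dist a (pt f) \<le> r"
    by (simp add: rel_cball_def)
  then obtain g where g: "\<And>f. f \<in> T \<Longrightarrow> g f \<in> A" "\<And>f. f \<in> T \<Longrightarrow> dist (g f) (pt f) \<le> r"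
    by metis
  have "inj_on g T"
  proof
    fix f f' assume f: "f \<in> T" "f' \<in> T" "g f = g f'"
    show "f = f'"
    proof (rule ccontr)
      assume "f \<noteq> f'"
      then obtain i where i: "f i \<noteq> f' i" by (auto simp: fun_eq_iff)
      have "(1/2) ^ t \<le> \<bar>digit_sum (f i) - digit_sum (f' i)\<bar>"
        using T(2)[OF f(1), of i] T(2)[OF f(2), of i] i by (intro digit_sum_separated) auto
      also have "digit_sum (f i) - digit_sum (f' i) = (pt f - pt f') $ i"
        using split f by (simp add: pt_def digit_vec_def)
      also have "\<bar>(pt f - pt f') $ i\<bar> \<le> dist (pt f) (pt f')"
        unfolding dist_norm by (rule component_le_norm_cart)
      also have "\<dots> \<le> 2 * r"
        using g(2)[OF f(1)] g(2)[OF f(2)] f(3) dist_triangle[of "pt f" "pt f'" "g f"]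
        by (simp add: dist_commute)
      finally show False using r by simp
    qed
  qed
  then have "card T \<le> card A"
    using g(1) A by (intro card_inj_on_le[of g]) (auto simp: is_cover_def)
  moreover have "card T = 2 ^ (CARD('n) * card (J \<inter> {s<..t}))"
    unfolding T_def by (rule card_vec_subsets) simp
  ultimately show ?thesis by simp
qed

text \<open>Truncations of the expansions at place \<open>t\<close> serve as centres.\<close>

lemma digit_cube_covering_upper:
  fixes v :: "real^'n"
  assumes X: "(+) v ` digit_cube J \<subseteq> X" and r: "real CARD('n) * (1/2) ^ t \<le> r"
  obtains A where "is_cover X r ((+) v ` digit_cube J) A"
    "card A \<le> 2 ^ (CARD('n) * card (J \<inter> {..t}))"
proof -
  define T where "T = (UNIV \<rightarrow>\<^sub>E Pow (J \<inter> {..t}) :: ('n \<Rightarrow> nat set) set)"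
  define A where "A = (\<lambda>f. v + digit_vec f) ` T"
  have finT: "finite T" by (auto simp: T_def intro!: finite_PiE)
  have sub: "A \<subseteq> X"
  proof
    fix a assume "a \<in> A"
    then obtain f where f: "f \<in> T" "a = v + digit_vec f" by (auto simp: A_def)
    have "f i \<subseteq> J \<inter> {..t}" for i using f(1) by (auto simp: T_def)
    then have "digit_vec f \<in> digit_cube J"
      by (intro digit_vec_in_cube) (auto intro: finite_subset)
    then show "a \<in> X" using X f by blast
  qed
  have "(+) v ` digit_cube J \<subseteq> (\<Union>a\<in>A. rel_cball X a r)"
  proof
    fix y assume y: "y \<in> (+) v ` digit_cube J"
    then obtain x where x: "x \<in> digit_cube J" "y = v + x" by blast
    obtain B where B: "\<And>i. finite (B i)" "\<And>i. B i \<subseteq> J" "y = v + digit_vec B"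
      using digit_cubeE[OF x(1)] x(2) by metis
    define f where "f = (\<lambda>i. B i \<inter> {..t})"
    have f: "f \<in> T" using B(2) by (auto simp: T_def f_def)
    have "dist (v + digit_vec f) y \<le> real CARD('n) * (1/2) ^ t"
    proof (rule dist_le_component_bound)
      fix i
      have "digit_sum (B i) = digit_sum (f i \<union> B i \<inter> {t<..})"
        by (rule arg_cong[where f = digit_sum]) (auto simp: f_def)
      also have "\<dots> = digit_sum (f i) + digit_sum (B i \<inter> {t<..})"
        using B(1) by (intro digit_sum_Un_disjoint) (auto simp: f_def)
      finally have "(v + digit_vec f) $ i - y $ i = - digit_sum (B i \<inter> {t<..})"
        by (simp add: B(3) digit_vec_def)
      moreover have "digit_sum (B i \<inter> {t<..}) < (1/2) ^ t"
        using B(1) by (intro digit_sum_less) auto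
      ultimately show "\<bar>(v + digit_vec f) $ i - y $ i\<bar> \<le> (1/2) ^ t"
        using digit_sum_nonneg[of "B i \<inter> {t<..}"] by linarith
    qed
    then show "y \<in> (\<Union>a\<in>A. rel_cball X a r)"
    proof (intro UN_I)
      show "v + digit_vec f \<in> A" using f by (simp add: A_def)
      show "y \<in> rel_cball X (v + digit_vec f) r"
        using \<open>dist (v + digit_vec f) y \<le> _\<close> r X y by (auto simp: rel_cball_def)
    qed
  qed
  moreover have "card A \<le> 2 ^ (CARD('n) * card (J \<inter> {..t}))"
  proof -
    have "card T = 2 ^ (CARD('n) * card (J \<inter> {..t}))"
      unfolding T_def by (rule card_vec_subsets) simp
    then show ?thesis unfolding A_def using card_image_le[OF finT] by metis
  qed
  ultimately show thesis
    using finT sub by (intro that[of A]) (simp_all add: is_cover_def A_def)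
qed

section \<open>Digit sets following an admissible profile\<close>

lemma half_power: "(1/2 :: real) ^ j = 2 powr (- real j)"
  by (simp add: powr_minus powr_realpow power_one_over inverse_eq_divide)

text \<open>
  The coordinate \<open>i0\<close> is the direction along which the pieces of the set are lined up.
\<close>

locale admissible_profile =
  fixes \<phi> :: "real \<Rightarrow> real" and i0 :: "'n::finite" and d :: real
  assumes d_def: "d = real CARD('n)"
    and nonneg: "\<lbrakk>0 < \<theta>; \<theta> \<le> 1\<rbrakk> \<Longrightarrow> 0 \<le> \<phi> \<theta>"
    and super: "\<lbrakk>0 < \<mu>; \<mu> \<le> 1; 0 < \<theta>; \<theta> \<le> 1\<rbrakk> \<Longrightarrow> \<phi> \<theta> + \<theta> * \<phi> \<mu> \<le> \<phi> (\<mu> * \<theta>)"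
    and sub: "\<lbrakk>0 < \<mu>; \<mu> \<le> 1; 0 < \<theta>; \<theta> \<le> 1\<rbrakk>
      \<Longrightarrow> \<phi> (\<mu> * \<theta>) \<le> \<theta> * \<phi> \<mu> + (1 - \<theta>) * d"
begin

lemma d_ge_1: "1 \<le> d" by (simp add: d_def Suc_le_eq)

lemma phi_one: "\<phi> 1 = 0"
  using nonneg[of 1] super[of 1 1] by simp

lemma phi_le: "\<lbrakk>0 < \<theta>; \<theta> \<le> 1\<rbrakk> \<Longrightarrow> \<phi> \<theta> \<le> (1 - \<theta>) * d"
  using sub[of 1 \<theta>] by (simp add: phi_one)

text \<open>
  Up to a bounded error, the logarithm to base 2 of the covering number at scale \<open>2 powr (-u)\<close> of
  the thin piece of diameter about \<open>2 powr (-k)\<close>. It is meant for \<open>u \<ge> k\<close>.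
\<close>

definition profile :: "real \<Rightarrow> real \<Rightarrow> real" where
  "profile k u = u * \<phi> (k / u)"

lemma profile_self: "profile k k = 0"
  by (simp add: profile_def phi_one)

text \<open>
  Supermultiplicativity at \<open>\<mu> = k / u\<close> and \<open>\<theta> = u / w\<close>: between the scales \<open>u\<close> and \<open>w\<close> the thin
  piece has at least the growth that \<open>\<phi>\<close> prescribes for the ratio \<open>u / w\<close>.
\<close>

lemma profile_diff_ge:
  assumes "0 < k" "k \<le> u" "u \<le> w"
  shows "w * \<phi> (u / w) \<le> profile k w - profile k u"
proof -
  have "\<phi> (u/w) + (u/w) * \<phi> (k/u) \<le> \<phi> (k/u * (u/w))" using assms by (intro super) auto
  then have "w * (\<phi> (u/w) + (u/w) * \<phi> (k/u)) \<le> w * \<phi> (k/w)"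
    using assms by (intro mult_left_mono) auto
  then show ?thesis using assms by (simp add: profile_def algebra_simps)
qed

text \<open>
  The other inequality at the same arguments: the profile never grows faster than the covering number
  of an open subset of the ambient space.
\<close>

lemma profile_diff_le:
  assumes "0 < k" "k \<le> u" "u \<le> w"
  shows "profile k w - profile k u \<le> d * (w - u)"
proof -
  have "\<phi> (k/u * (u/w)) \<le> (u/w) * \<phi> (k/u) + (1 - u/w) * d" using assms by (intro sub) auto
  then have "w * \<phi> (k/w) \<le> w * ((u/w) * \<phi> (k/u) + (1 - u/w) * d)"
    using assms by (intro mult_left_mono) auto
  also have "\<dots> = u * \<phi> (k/u) + d * (w - u)" using assms by (simp add: field_simps)
  finally show ?thesis by (simp add: profile_def)
qed

lemma profile_mono:
  assumes "0 < k" "k \<le> u" "u \<le> w"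
  shows "profile k u \<le> profile k w"
proof -
  have "0 \<le> w * \<phi> (u / w)" using assms nonneg[of "u/w"] by simp
  then show ?thesis using profile_diff_ge[OF assms] by linarith
qed

text \<open>
  The increments of \<open>profile k j / d\<close> per unit step lie in \<open>[0, 1]\<close>, so its integer part increases
  by 0 or 1; the places where it increases are those whose digits are left free in the thin piece.
\<close>

definition branching :: "nat \<Rightarrow> nat set" where
  "branching k = {j. k < j \<and> \<lfloor>profile k (real j - 1) / d\<rfloor> < \<lfloor>profile k j / d\<rfloor>}"

lemma card_branching:
  assumes "1 \<le> k" "k \<le> s" "s \<le> t"
  shows "int (card (branching k \<inter> {s<..t})) = \<lfloor>profile k t / d\<rfloor> - \<lfloor>profile k s / d\<rfloor>"
  using assms(3)
proof (induction t rule: dec_induct)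
  case (step t)
  let ?f = "\<lambda>j::nat. \<lfloor>profile k j / d\<rfloor>"
  have "profile k (Suc t) / d \<le> (profile k t + d) / d" "profile k t / d \<le> profile k (Suc t) / d"
    using assms step d_ge_1 profile_diff_le[of k t "Suc t"] profile_mono[of k t "Suc t"]
    by (intro divide_right_mono; simp)+
  then have f: "?f t \<le> ?f (Suc t)" "?f (Suc t) \<le> ?f t + 1"
    using d_ge_1 by (simp_all add: add_divide_distrib floor_le_iff) linarith+
  have mem: "Suc t \<in> branching k \<longleftrightarrow> ?f t < ?f (Suc t)"
    using assms step by (simp add: branching_def)
  show ?case
  proof (cases "?f t < ?f (Suc t)")
    case True
    then have "branching k \<inter> {s<..Suc t} = insert (Suc t) (branching k \<inter> {s<..t})"
      using mem step by auto
    then show ?thesis using True f step.IH by simp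
  next
    case False
    then have "branching k \<inter> {s<..Suc t} = branching k \<inter> {s<..t}"
      using mem by (auto simp: le_Suc_eq)
    then show ?thesis using False f step.IH by simp
  qed
qed simp

lemma branching_count_ge:
  assumes "1 \<le> k" "k \<le> s" "s \<le> t"
  shows "profile k t - profile k s - d \<le> d * real (card (branching k \<inter> {s<..t}))"
proof -
  have "profile k t / d - 1 - profile k s / d
      \<le> real_of_int (\<lfloor>profile k t / d\<rfloor> - \<lfloor>profile k s / d\<rfloor>)" by linarith
  also have "\<dots> = real (card (branching k \<inter> {s<..t}))"
    using card_branching[OF assms] by (metis of_int_of_nat_eq)
  finally have "d * (profile k t / d - 1 - profile k s / d) \<le> d * real (card (branching k \<inter> {s<..t}))"
    using d_ge_1 by (intro mult_left_mono) auto
  then show ?thesis using d_ge_1 by (simp add: right_diff_distrib)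
qed

lemma branching_count_le:
  assumes "1 \<le> k" "k \<le> t"
  shows "d * real (card (branching k \<inter> {..t})) \<le> profile k t"
proof -
  have "branching k \<inter> {..t} = branching k \<inter> {k<..t}" by (auto simp: branching_def)
  then have "real (card (branching k \<inter> {..t})) = real_of_int \<lfloor>profile k t / d\<rfloor>"
    using card_branching[OF assms(1) order_refl assms(2)]
    by (simp add: profile_self)
  also have "\<dots> \<le> profile k t / d" by linarith
  finally show ?thesis using d_ge_1 by (simp add: pos_le_divide_eq mult.commute)
qed

text \<open>
  The estimate for balls of logarithmic radius \<open>\<theta> * \<tau>\<close> and covering scale \<open>\<tau>\<close> that are at most
  a bounded factor larger than the thin piece. The numbers \<open>s\<close> and \<open>t\<close> are integer substitutes for
  \<open>\<theta> * \<tau>\<close> and \<open>\<tau>\<close>. Since \<open>\<theta> * \<tau>\<close> may lie before the start \<open>k\<close> of the profile, the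
  profile is compared at \<open>u = max k (\<theta> * \<tau>)\<close> and \<open>u / \<theta>\<close>, whose ratio is still \<open>\<theta>\<close>; the
  Lipschitz bound for the profile controls the error.
\<close>

lemma branching_count_near:
  assumes \<theta>: "0 < \<theta>" "\<theta> < 1" and k: "1 \<le> k" "real k - d - 2 \<le> \<theta> * \<tau>"
    and s: "k \<le> s" "\<theta> * \<tau> \<le> s" "s \<le> \<theta> * \<tau> + d + 3" and t: "s \<le> t" "\<tau> - 2 \<le> t" "t \<le> \<tau>"
  shows "\<tau> * \<phi> \<theta> - d * (d + 6 + (d + 2) / \<theta>) \<le> d * real (card (branching k \<inter> {s<..t}))"
proof -
  define u where "u = max (real k) (\<theta> * \<tau>)"
  have u: "real k \<le> u" "\<theta> * \<tau> \<le> u" "u \<le> s" "u - \<theta> * \<tau> \<le> d + 2"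
    using s k d_ge_1 by (auto simp: u_def)
  have uk: "real k > 0" using k by simp
  have \<tau>u: "\<tau> \<le> u / \<theta>" using u \<theta> by (simp add: field_simps)
  have "u \<le> u / \<theta>" using \<theta> u uk by (simp add: field_simps)
  then have "u / \<theta> * \<phi> \<theta> \<le> profile k (u/\<theta>) - profile k u"
    using profile_diff_ge[of k u "u/\<theta>"] \<theta> u uk by simp
  moreover have "\<tau> * \<phi> \<theta> \<le> u / \<theta> * \<phi> \<theta>"
    using \<tau>u nonneg[of \<theta>] \<theta> by (intro mult_right_mono) auto
  moreover have "profile k (u/\<theta>) - profile k \<tau> \<le> d * ((d + 2) / \<theta>)"
  proof -
    have "profile k (u/\<theta>) - profile k \<tau> \<le> d * (u/\<theta> - \<tau>)"
      using s t \<tau>u uk by (intro profile_diff_le) auto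
    also have "u/\<theta> - \<tau> = (u - \<theta> * \<tau>) / \<theta>" using \<theta> by (simp add: field_simps)
    also have "d * \<dots> \<le> d * ((d + 2) / \<theta>)"
      using u \<theta> d_ge_1 by (intro mult_left_mono divide_right_mono) auto
    finally show ?thesis .
  qed
  moreover have "profile k \<tau> - profile k t \<le> d * 2"
  proof -
    have "profile k \<tau> - profile k t \<le> d * (\<tau> - t)" using s t uk by (intro profile_diff_le) auto
    also have "\<dots> \<le> d * 2" using t d_ge_1 by (intro mult_left_mono) auto
    finally show ?thesis .
  qed
  moreover have "profile k s - profile k u \<le> d * (d + 3)"
  proof -
    have "profile k s - profile k u \<le> d * (s - u)" using u uk by (intro profile_diff_le) auto
    also have "\<dots> \<le> d * (d + 3)" using s u d_ge_1 by (intro mult_left_mono) auto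
    finally show ?thesis .
  qed
  moreover have "profile k t - profile k s - d \<le> d * real (card (branching k \<inter> {s<..t}))"
    using k s t by (intro branching_count_ge) auto
  ultimately show ?thesis by (simp add: algebra_simps)
qed

subsection \<open>The union of thin and full pieces and its spectrum\<close>

definition anchor :: "real \<Rightarrow> real^'n" where
  "anchor c = axis i0 c"

lemma anchor_component: "anchor c $ i = (if i = i0 then c else 0)"
  by (simp add: anchor_def axis_def)

text \<open>
  In direction \<open>i0\<close> the \<open>k\<close>-th pair of pieces occupies \<open>[4k, 4k + 3)\<close>, so distinct pairs have
  distance at least 1. Inside a pair the gap has width about \<open>(1/2) ^ k\<close>, the size of the thin piece:
  wide enough to isolate it at that scale, and narrow enough for larger balls to reach the full piece.
\<close>

definition thin_piece :: "nat \<Rightarrow> (real^'n) set" where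
  "thin_piece k = (+) (anchor (4 * k)) ` digit_cube (branching k)"

definition full_piece :: "nat \<Rightarrow> (real^'n) set" where
  "full_piece k = (+) (anchor (4 * k + 2 * (1/2) ^ k)) ` digit_cube {0<..}"

definition spectrum_set :: "(real^'n) set" where
  "spectrum_set = (\<Union>k\<in>{1..}. thin_piece k \<union> full_piece k)"

lemma thin_piece_subset: "1 \<le> k \<Longrightarrow> thin_piece k \<subseteq> spectrum_set"
  by (auto simp: spectrum_set_def)

lemma full_piece_subset: "1 \<le> k \<Longrightarrow> full_piece k \<subseteq> spectrum_set"
  by (auto simp: spectrum_set_def)

lemma thin_piece_bounds:
  assumes "x \<in> thin_piece k"
  shows "4 * real k \<le> x $ i0" "x $ i0 < 4 * real k + (1/2) ^ k"
proof -
  obtain y :: "real^'n" where "y \<in> digit_cube (branching k)" "x = anchor (4 * k) + y"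
    using assms by (auto simp: thin_piece_def)
  moreover have "branching k \<subseteq> {k<..}" by (auto simp: branching_def)
  ultimately show "4 * real k \<le> x $ i0" "x $ i0 < 4 * real k + (1/2) ^ k"
    using digit_cube_component_bounds[of y "branching k" k i0] by (auto simp: anchor_component)
qed

lemma full_piece_bounds:
  assumes "x \<in> full_piece k"
  shows "4 * real k + 2 * (1/2) ^ k \<le> x $ i0" "x $ i0 < 4 * real k + 3"
proof -
  obtain y :: "real^'n" where y: "y \<in> digit_cube {0<..}" "x = anchor (4 * k + 2 * (1/2) ^ k) + y"
    using assms by (auto simp: full_piece_def)
  have "(1/2 :: real) ^ k \<le> 1" by (simp add: power_le_one)
  then show "4 * real k + 2 * (1/2) ^ k \<le> x $ i0" "x $ i0 < 4 * real k + 3"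
    using digit_cube_component_bounds[OF y(1) order_refl, of i0] y(2) by (auto simp: anchor_component)
qed

lemma small_ball_in_thin_piece:
  assumes x: "x \<in> thin_piece k" and k: "1 \<le> k"
  shows "rel_cball spectrum_set x ((1/2) ^ k) \<subseteq> thin_piece k"
proof
  fix y assume "y \<in> rel_cball spectrum_set x ((1/2) ^ k)"
  then have y: "y \<in> spectrum_set" "dist x y \<le> (1/2) ^ k" by (auto simp: rel_cball_def)
  have xy: "\<bar>x $ i0 - y $ i0\<bar> \<le> (1/2) ^ k"
    using y(2) component_le_norm_cart[of "x - y" i0] by (simp add: dist_norm)
  have small: "(1/2 :: real) ^ j \<le> 1/2" if "1 \<le> j" for j
    using power_decreasing[OF that, of "1/2 :: real"] by simp
  note xb = thin_piece_bounds[OF x]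
  obtain l where l: "1 \<le> l" "y \<in> thin_piece l \<or> y \<in> full_piece l"
    using y(1) by (auto simp: spectrum_set_def)
  have yb: "4 * real l \<le> y $ i0" "y $ i0 < 4 * real l + 3"
    using l small[OF l(1)] thin_piece_bounds[of y l] full_piece_bounds[of y l]
      zero_le_power[of "1/2 :: real" l] by linarith+
  have "\<not> k < l" "\<not> l < k"
  proof -
    show "\<not> k < l"
    proof
      assume "k < l"
      then have "real k + 1 \<le> real l" by simp
      then show False using xb yb xy small[OF k] by linarith
    qed
    show "\<not> l < k"
    proof
      assume "l < k"
      then have "real l + 1 \<le> real k" by simp
      then show False using xb yb xy small[OF k] by linarith
    qed
  qed
  then have "l = k" by simp
  moreover have "y \<notin> full_piece k" using full_piece_bounds[of y k] xb xy by auto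
  ultimately show "y \<in> thin_piece k" using l by blast
qed

text \<open>
  Test the growth condition on the radii \<open>r\<close> with \<open>r powr \<theta> = (1/2) ^ k\<close> and on the corner of the
  thin piece. The ball lies in the thin piece, whose covering number at the scale
  \<open>w = k / \<theta>\<close> is about \<open>2 powr (profile k w) = 2 powr (w * \<phi> \<theta>)\<close>. An exponent \<open>p > \<phi> \<theta>\<close> is
  refuted by \<open>k\<close> tending to infinity.
\<close>

lemma covering_growth_le:
  assumes \<theta>: "0 < \<theta>" "\<theta> < 1" and "covering_growth spectrum_set \<theta> p"
  shows "p \<le> \<phi> \<theta>"
proof (rule ccontr)
  assume p: "\<not> p \<le> \<phi> \<theta>"
  obtain C where C: "C > 0"
    "\<And>r x A. 0 < r \<Longrightarrow> r < 1 \<Longrightarrow> x \<in> spectrum_set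
       \<Longrightarrow> is_cover spectrum_set r (rel_cball spectrum_set x (r powr \<theta>)) A
       \<Longrightarrow> C * r powr (-p) \<le> real (card A)"
    using assms(3) unfolding covering_growth_def by blast
  have bound: "C * 2 powr (real k * ((p - \<phi> \<theta>) / \<theta>)) \<le> 2 powr (d * (d + 1))" if k: "1 \<le> k" for k
  proof -
    define w where "w = real k / \<theta>"
    have w: "0 < w" "k \<le> w" "\<theta> * w = k" using k \<theta> by (auto simp: w_def field_simps)
    define r where "r = 2 powr (-w)"
    have r: "0 < r" "r < 1" using w powr_less_one[of 2 "- w"] by (auto simp: r_def)
    have r\<theta>: "r powr \<theta> = (1/2) ^ k"
      using w unfolding half_power by (simp add: r_def powr_powr mult.commute)
    \<comment> \<open>The summand \<open>CARD('n)\<close> absorbs the factor \<open>d\<close> in \<open>d * (1/2) ^ t \<le> r\<close>.\<close>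
    define t where "t = nat \<lceil>w\<rceil> + CARD('n)"
    have t: "w + d \<le> t" "t \<le> w + d + 1" "k \<le> t" using w unfolding t_def d_def by linarith+
    have "d * (1/2) ^ t \<le> r"
    proof -
      have "(1/2 :: real) ^ t = 2 powr (- real t)" by (rule half_power)
      also have "\<dots> \<le> 2 powr (- (w + d))" using t by simp
      also have "\<dots> = r * (1 / 2 ^ CARD('n))"
        by (simp add: r_def d_def powr_diff powr_realpow)
      finally have "d * (1/2) ^ t \<le> d * (r * (1 / 2 ^ CARD('n)))" by (intro mult_left_mono) (auto simp: d_def)
      also have "\<dots> = r * (d / 2 ^ CARD('n))" by simp
      also have "\<dots> \<le> r * 1"
        using r less_imp_le[OF of_nat_less_two_power[of "CARD('n)", where 'a = real]]
        by (intro mult_left_mono) (auto simp: d_def)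
      finally show ?thesis by simp
    qed
    then obtain A where A: "is_cover spectrum_set r (thin_piece k) A"
      "card A \<le> 2 ^ (CARD('n) * card (branching k \<inter> {..t}))"
      using digit_cube_covering_upper[where 'n = 'n, folded d_def, of "anchor (4 * k)" "branching k" spectrum_set t r]
        thin_piece_subset[OF k] unfolding thin_piece_def by metis
    have v: "anchor (4 * k) \<in> thin_piece k"
      using zero_in_digit_cube by (force simp: thin_piece_def)
    have "C * r powr (-p) \<le> real (card A)"
    proof (rule C(2)[OF r])
      show "anchor (4 * k) \<in> spectrum_set" using v thin_piece_subset[OF k] by blast
      show "is_cover spectrum_set r (rel_cball spectrum_set (anchor (4 * k)) (r powr \<theta>)) A"
        using A(1) small_ball_in_thin_piece[OF v k] unfolding r\<theta> is_cover_def by blast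
    qed
    also have "real (card A) \<le> real (2 ^ (CARD('n) * card (branching k \<inter> {..t})))"
      using A(2) by (simp only: of_nat_le_iff)
    also have "\<dots> = 2 powr (d * real (card (branching k \<inter> {..t})))"
      by (simp add: d_def powr_realpow[symmetric])
    also have "\<dots> \<le> 2 powr (w * \<phi> \<theta> + d * (d + 1))"
    proof -
      have "d * real (card (branching k \<inter> {..t})) \<le> profile k t"
        using branching_count_le k t by simp
      also have "\<dots> \<le> profile k w + d * (t - w)"
        using profile_diff_le[of k w t] k w t d_ge_1 by simp
      also have "profile k w = w * \<phi> \<theta>" using w k \<theta> by (simp add: profile_def w_def)
      also have "d * (t - w) \<le> d * (d + 1)" using t d_ge_1 by (intro mult_left_mono) auto
      finally show ?thesis by simp
    qed
    finally have "C * 2 powr (w * p) * 2 powr (- (w * \<phi> \<theta>))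
        \<le> 2 powr (w * \<phi> \<theta> + d * (d + 1)) * 2 powr (- (w * \<phi> \<theta>))"
      by (intro mult_right_mono) (simp_all add: r_def powr_powr)
    then show ?thesis
      by (simp add: mult.assoc powr_add[symmetric] w_def right_diff_distrib diff_divide_distrib)
  qed
  define b where "b = (p - \<phi> \<theta>) / \<theta>"
  have b: "b > 0" using p \<theta> by (simp add: b_def)
  define L where "L = log 2 (2 powr (d * (d + 1)) / C)"
  obtain k :: nat where k: "max 1 (L / b) < real k" using reals_Archimedean2 by blast
  have "2 powr (real k * b) \<le> 2 powr (d * (d + 1)) / C"
    using bound[of k] k C(1) by (simp add: b_def pos_le_divide_eq mult.commute)
  also have "\<dots> = 2 powr L" using C(1) by (simp add: L_def)
  finally have "real k * b \<le> L" by simp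
  moreover have "L < real k * b" using k b by (simp add: pos_divide_less_eq)
  ultimately show False by linarith
qed

lemma full_piece_covering_lower:
  assumes x: "x \<in> full_piece k" and k: "1 \<le> k" and R: "d * (1/2) ^ s \<le> R" and r: "2 * r < (1/2) ^ t"
    and A: "is_cover spectrum_set r (rel_cball spectrum_set x R) A"
  shows "2 ^ (CARD('n) * (t - s)) \<le> card A"
proof -
  obtain y :: "real^'n" where y: "y \<in> digit_cube {0<..}" "x = anchor (4 * k + 2 * (1/2) ^ k) + y"
    using x by (auto simp: full_piece_def)
  have "{0<..} \<inter> {s<..t} = {s<..t}" by auto
  then show ?thesis
    using digit_cube_covering_lower[where 'n = 'n, folded d_def, OF y(1) _ R r, of "anchor (4 * k + 2 * (1/2) ^ k)" spectrum_set A]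
      A full_piece_subset[OF k] unfolding y(2) full_piece_def by simp
qed

lemma thin_piece_near_full_piece:
  assumes x: "x \<in> thin_piece k" and k: "1 \<le> k" and R: "d * (4 * (1/2) ^ k) \<le> R"
  obtains y where "y \<in> full_piece k" "rel_cball spectrum_set y (R / 2) \<subseteq> rel_cball spectrum_set x R"
proof -
  define y where "y = anchor (4 * k + 2 * (1/2) ^ k)"
  obtain z :: "real^'n" where z: "z \<in> digit_cube (branching k)" "x = anchor (4 * k) + z"
    using x by (auto simp: thin_piece_def)
  have br: "branching k \<subseteq> {k<..}" by (auto simp: branching_def)
  have "dist x y \<le> d * (2 * (1/2) ^ k)"
    unfolding d_def
  proof (rule dist_le_component_bound)
    fix i
    show "\<bar>x $ i - y $ i\<bar> \<le> 2 * (1/2) ^ k"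
      using digit_cube_component_bounds[OF z(1) br, of i] unfolding z(2) y_def
      by (cases "i = i0") (auto simp: anchor_component abs_le_iff simp del: zero_le_power)
  qed
  also have "\<dots> \<le> R / 2" using R by simp
  finally have xy: "dist x y \<le> R / 2" .
  show thesis
  proof
    show "y \<in> full_piece k" using zero_in_digit_cube by (force simp: full_piece_def y_def)
    show "rel_cball spectrum_set y (R / 2) \<subseteq> rel_cball spectrum_set x R"
    proof
      fix w assume "w \<in> rel_cball spectrum_set y (R / 2)"
      then show "w \<in> rel_cball spectrum_set x R"
        using xy dist_triangle[of x w y] by (auto simp: rel_cball_def)
    qed
  qed
qed

text \<open>
  Around a point of a full piece, all digits between the two scales may vary inside the ball, and
  \<open>\<phi> \<theta> \<le> (1 - \<theta>) * d\<close> suffices. Around a point of the thin piece with index \<open>k\<close>, balls of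
  logarithmic radius \<open>\<theta> * \<tau> < k - d - 2\<close> reach the full piece, and smaller balls are treated
  by the profile.
\<close>

lemma covering_growth_ge:
  assumes \<theta>: "0 < \<theta>" "\<theta> < 1"
  shows "covering_growth spectrum_set \<theta> (\<phi> \<theta>)"
proof -
  define E where "E = d * (d + 6 + (d + 2) / \<theta>)"
  have E: "d * (d + 6) \<le> E" using \<theta> d_ge_1 by (simp add: E_def)
  have "2 powr (-E) * r powr (- \<phi> \<theta>) \<le> real (card A)"
    if r: "0 < r" "r < 1" and x: "x \<in> spectrum_set"
      and A: "is_cover spectrum_set r (rel_cball spectrum_set x (r powr \<theta>)) A" for r x A
  proof -
    define \<tau> where "\<tau> = - log 2 r"
    have \<tau>: "0 < \<tau>" "r = 2 powr (-\<tau>)" using r by (auto simp: \<tau>_def)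
    define R where "R = r powr \<theta>"
    have R: "R = 2 powr (- (\<theta> * \<tau>))" by (simp add: R_def \<tau>(2) powr_powr mult.commute)
    \<comment> \<open>The summand \<open>CARD('n) + 2\<close> serves two ends: \<open>d * (1/2) ^ s \<le> R / 2\<close>, and \<open>k \<le> s\<close>
      for all balls that need not reach a full piece.\<close>
    define s where "s = nat \<lceil>\<theta> * \<tau>\<rceil> + CARD('n) + 2"
    define t where "t = nat \<lceil>\<tau>\<rceil> - 2"
    have "0 < \<theta> * \<tau>" using \<theta> \<tau> by simp
    then have s: "\<theta> * \<tau> + d + 2 \<le> s" "s \<le> \<theta> * \<tau> + d + 3" unfolding s_def d_def by linarith+
    have t: "\<tau> - 2 \<le> t" unfolding t_def by linarith
    have d_pow: "d \<le> 2 powr d"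
      using less_imp_le[OF of_nat_less_two_power[of "CARD('n)", where 'a = real]]
      by (simp add: d_def powr_realpow)
    have "\<tau> * \<phi> \<theta> \<le> \<tau> * ((1 - \<theta>) * d)"
      using \<tau> phi_le[of \<theta>] \<theta> by (intro mult_left_mono) auto
    also have "\<dots> = d * (\<tau> - \<theta> * \<tau>)" by (simp add: algebra_simps)
    also have "\<dots> \<le> d * (real t - real s + d + 5)"
      using s t d_ge_1 by (intro mult_left_mono) auto
    also have "\<dots> \<le> d * (real t - real s) + E"
      using E d_ge_1 by (simp add: algebra_simps)
    finally \<comment> \<open>Enough whenever all digits are free, and also when no place is left between \<open>s\<close> and \<open>t\<close>.\<close>
 have crude: "\<tau> * \<phi> \<theta> - E \<le> d * (real t - real s)" by simp
    have suffices: "2 powr (-E) * r powr (- \<phi> \<theta>) \<le> real (card A)"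
      if "\<tau> * \<phi> \<theta> - E \<le> d * real m" "2 ^ (CARD('n) * m) \<le> card A" for m
    proof -
      have "2 powr (-E) * r powr (- \<phi> \<theta>) = 2 powr (\<tau> * \<phi> \<theta> - E)"
        by (simp add: \<tau>(2) powr_powr powr_add[symmetric])
      also have "\<dots> \<le> 2 powr (d * real m)" using that(1) by simp
      also have "\<dots> = real (2 ^ (CARD('n) * m))" by (simp add: d_def powr_realpow[symmetric])
      also have "\<dots> \<le> real (card A)" using that(2) by (simp only: of_nat_le_iff)
      finally show ?thesis .
    qed
    show ?thesis
    proof (cases "s < t")
      case False
      then have "d * (real t - real s) \<le> 0" using d_ge_1 by (simp add: mult_nonneg_nonpos)
      moreover have "1 \<le> card A" using is_cover_card_ge_1[OF A x] by simp
      ultimately show ?thesis using crude by (intro suffices[of 0]) auto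
    next
      case st: True
      have "t < \<tau> - 1" using st unfolding t_def by linarith
      then have r_t: "2 * r < (1/2) ^ t"
        unfolding half_power by (simp add: \<tau>(2) powr_mult_base)
      have R_s: "d * (1/2) ^ s \<le> R / 2"
      proof -
        have "d * (1/2) ^ s \<le> 2 powr d * 2 powr (- (\<theta> * \<tau> + d + 2))"
          unfolding half_power using d_pow s d_ge_1 by (intro mult_mono) auto
        also have "\<dots> = R * 2 powr (-2)" unfolding R by (simp add: powr_add[symmetric])
        also have "\<dots> \<le> R * (1/2)" by (intro mult_left_mono) (auto simp: R powr_minus)
        finally show ?thesis by simp
      qed
      have R_pos: "0 < R" by (simp add: R)
      have full: ?thesis
        if "y \<in> full_piece k" "1 \<le> k" "rel_cball spectrum_set y (R/2) \<subseteq> rel_cball spectrum_set x R"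
        for y k
      proof (rule suffices[of "t - s"])
        have "is_cover spectrum_set r (rel_cball spectrum_set y (R/2)) A"
          using A that(3) unfolding is_cover_def R_def by blast
        then show "2 ^ (CARD('n) * (t - s)) \<le> card A"
          using full_piece_covering_lower[OF that(1,2) R_s r_t] by blast
        show "\<tau> * \<phi> \<theta> - E \<le> d * real (t - s)" using crude st by (simp add: of_nat_diff)
      qed
      obtain k where k: "1 \<le> k" "x \<in> thin_piece k \<or> x \<in> full_piece k"
        using x by (auto simp: spectrum_set_def)
      show ?thesis
      proof (cases "x \<in> full_piece k")
        case True
        have "rel_cball spectrum_set x (R/2) \<subseteq> rel_cball spectrum_set x R"
          using R_pos by (auto simp: rel_cball_def)
        then show ?thesis using full[OF True k(1)] by blast
      next
        case False
        then have xk: "x \<in> thin_piece k" using k by blast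
        show ?thesis
        proof (cases "real k - d - 2 \<le> \<theta> * \<tau>")
          case True
          obtain z :: "real^'n" where z: "z \<in> digit_cube (branching k)" "x = anchor (4 * k) + z"
            using xk by (auto simp: thin_piece_def)
          have "d * (1/2) ^ s \<le> R" using R_s R_pos by linarith
          then have "2 ^ (CARD('n) * card (branching k \<inter> {s<..t})) \<le> card A"
            using digit_cube_covering_lower[where 'n = 'n, folded d_def, OF z(1) _ _ r_t, of "anchor (4 * k)" spectrum_set s R A]
              A thin_piece_subset[OF k(1)] unfolding z(2) thin_piece_def R_def by blast
          moreover have "\<tau> * \<phi> \<theta> - E \<le> d * real (card (branching k \<inter> {s<..t}))"
            unfolding E_def using True k s t st \<open>t < \<tau> - 1\<close> d_ge_1 \<theta>
            by (intro branching_count_near) auto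
          ultimately show ?thesis by (intro suffices)
        next
          case False
          have "d * (4 * (1/2) ^ k) \<le> 2 powr d * (2 powr 2 * 2 powr (- real k))"
            unfolding half_power using d_pow by (intro mult_mono) (use d_ge_1 in auto)
          also have "\<dots> = 2 powr (d + 2 - real k)"
            by (simp only: mult.assoc[symmetric] powr_add[symmetric]) (simp add: algebra_simps)
          also have "\<dots> \<le> R" unfolding R using False by simp
          finally obtain y where "y \<in> full_piece k"
            "rel_cball spectrum_set y (R / 2) \<subseteq> rel_cball spectrum_set x R"
            using thin_piece_near_full_piece[OF xk k(1)] by blast
          then show ?thesis using full k(1) by blast
        qed
      qed
    qed
  qed
  moreover have "(0::real) < 2 powr (-E)" by simp
  ultimately show ?thesis unfolding covering_growth_def by blast
qed

lemma scaled_lower_spectrum_spectrum_set: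
  assumes "0 < \<theta>" "\<theta> \<le> 1"
  shows "scaled_lower_spectrum \<theta> spectrum_set = ereal (\<phi> \<theta>)"
proof (cases "\<theta> = 1")
  case True
  then show ?thesis by (simp add: scaled_lower_spectrum_def phi_one)
next
  case False
  then have \<theta>: "0 < \<theta>" "\<theta> < 1" using assms by auto
  have "covering_growth spectrum_set \<theta> t" if "t < \<phi> \<theta>" for t
    using covering_growth_antimono[OF covering_growth_ge[OF \<theta>]] that by simp
  then show ?thesis
    using covering_growth_le[OF \<theta>] nonneg[of \<theta>] \<theta>
    by (simp add: scaled_lower_spectrum_eq_iff)
qed

lemma spectrum_set_nonempty: "spectrum_set \<noteq> {}"
  using thin_piece_subset[of 1] zero_in_digit_cube[of "branching 1"] by (auto simp: thin_piece_def)

end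

section \<open>The characterisation of scaled lower spectra\<close>

theorem theoremA:
  fixes \<phi> :: "real \<Rightarrow> real"
  assumes "\<phi> \<in> {0<..1} \<rightarrow> {0..real CARD('n::finite)}"
  shows "(\<exists>F :: (real^'n) set. F \<noteq> {} \<and>
            (\<forall>\<theta>\<in>{0<..1}. scaled_lower_spectrum \<theta> F = ereal (\<phi> \<theta>)))
     \<longleftrightarrow> (\<forall>\<mu>\<in>{0<..1}. \<forall>\<theta>\<in>{0<..1}.
            \<phi> \<theta> \<le> \<phi> (\<mu> * \<theta>) - \<theta> * \<phi> \<mu> \<and>
            \<phi> (\<mu> * \<theta>) - \<theta> * \<phi> \<mu> \<le> (1 - \<theta>) * real CARD('n))"
    (is "?spectrum \<longleftrightarrow> ?inequalities")
proof
  have nonneg: "0 \<le> \<phi> \<theta>" if "0 < \<theta>" "\<theta> \<le> 1" for \<theta>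
    using assms that by (auto simp: Pi_iff)
  {
    assume ?spectrum
    then obtain F :: "(real^'n) set" where F: "F \<noteq> {}"
      and spec: "\<forall>\<theta>\<in>{0<..1}. scaled_lower_spectrum \<theta> F = ereal (\<phi> \<theta>)" by blast
    have spec: "scaled_lower_spectrum \<theta> F = ereal (\<phi> \<theta>)" if "0 < \<theta>" "\<theta> \<le> 1" for \<theta>
      using spec that by simp
    show ?inequalities using spectrum_inequalities[OF F spec nonneg] by simp
  next
    assume ineq: ?inequalities
    interpret admissible_profile \<phi> "undefined :: 'n" "real CARD('n)"
    proof
      fix \<mu> \<theta> :: real assume "0 < \<mu>" "\<mu> \<le> 1" "0 < \<theta>" "\<theta> \<le> 1"
      then have "\<phi> \<theta> \<le> \<phi> (\<mu> * \<theta>) - \<theta> * \<phi> \<mu>"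
        "\<phi> (\<mu> * \<theta>) - \<theta> * \<phi> \<mu> \<le> (1 - \<theta>) * real CARD('n)"
        using ineq by auto
      then show "\<phi> \<theta> + \<theta> * \<phi> \<mu> \<le> \<phi> (\<mu> * \<theta>)"
        "\<phi> (\<mu> * \<theta>) \<le> \<theta> * \<phi> \<mu> + (1 - \<theta>) * real CARD('n)" by linarith+
    qed (use nonneg in auto)
    show ?spectrum using spectrum_set_nonempty scaled_lower_spectrum_spectrum_set by auto
  }
qed

end
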